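(* Let $C$ be a tight bimonoidal category. Then the bimonoidal Drinfeld center $\overline{C}^{\mathsf{bi}}$, with the structure described in the context, is a tight braided bimonoidal category.
   Context: Write $AB$ for $A\otimes B$; $\otimes$ binds tighter than $\oplus$. A bimonoidal category is a category $C$ with a symmetric monoidal structure $(\oplus,0,\alpha^\oplus,\lambda^\oplus,\rho^\oplus,\zeta^\oplus)$, a monoidal structure $(\otimes,1,\alpha^\otimes,\lambda^\otimes,\rho^\otimes)$ (with $\alpha_{A,B,C}:(AB)C\to A(BC)$, $\lambda_A$, $\rho_A$ the left/right unit isomorphisms), natural isomorphisms $\lambda^\bullet_A:0A\to0$, $\rho^\bullet_A:A0\to 0$, and natural monomorphisms $\delta^l_{A,B,C}:A(B\oplus C)\to AB\oplus AC$, $\delta^r_{A,B,C}:(A\oplus B)C\to AC\oplus BC$, such that for all objects: $\delta^l_{A,C,B}(1\otimes\zeta^\oplus_{B,C})=\zeta^\oplus_{AB,AC}\delta^l_{A,B,C}$; $\delta^r_{B,A,C}(\zeta^\oplus_{A,B}\otimes1)=\zeta^\oplus_{AC,BC}\delta^r_{A,B,C}$; $\alpha^\oplus(\delta^r_{A,B,D}\oplus1)\delta^r_{A\oplus B,C,D}=(1\oplus\delta^r_{B,C,D})\delta^r_{A,B\oplus C,D}(\alpha^\oplus_{A,B,C}\otimes1)$; $\alpha^\oplus(\delta^l_{A,B,C}\oplus1)\delta^l_{A,B\oplus C,D}=(1\oplus\delta^l_{A,C,D})\delta^l_{A,B,C\oplus D}(1\otimes\alpha^\oplus_{B,C,D})$;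 $\delta^l_{A,BC,BD}(1\otimes\delta^l_{B,C,D})\alpha^\otimes_{A,B,C\oplus D}=(\alpha^\otimes_{A,B,C}\oplus\alpha^\otimes_{A,B,D})\delta^l_{AB,C,D}$; $(\alpha^\otimes_{A,C,D}\oplus\alpha^\otimes_{B,C,D})\delta^r_{AC,BC,D}(\delta^r_{A,B,C}\otimes1)=\delta^r_{A,B,CD}\alpha^\otimes_{A\oplus B,C,D}$; $(\alpha^\otimes_{A,B,D}\oplus\alpha^\otimes_{A,C,D})\delta^r_{AB,AC,D}(\delta^l_{A,B,C}\otimes1)=\delta^l_{A,BD,CD}(1\otimes\delta^r_{B,C,D})\alpha^\otimes_{A,B\oplus C,D}$; $\mu(\delta^l_{A,C,D}\oplus\delta^l_{B,C,D})\delta^r_{A,B,C\oplus D}=(\delta^r_{A,B,C}\oplus\delta^r_{A,B,D})\delta^l_{A\oplus B,C,D}$, where $\mu:(AC\oplus AD)\oplus(BC\oplus BD)\to(AC\oplus BC)\oplus(AD\oplus BD)$ is the coherence isomorphism exchanging the two middle summands; $\lambda^\bullet_0=\rho^\bullet_0$; $\lambda^\oplus_0(\lambda^\bullet_A\oplus\lambda^\bullet_B)\delta^l_{0,A,B}=\lambda^\bullet_{A\oplus B}$; $\lambda^\oplus_0(\rho^\bullet_A\oplus\rho^\bullet_B)\delta^r_{A,B,0}=\rho^\bullet_{A\oplus B}$; $\rho^\otimes_0=\lambda^\bullet_1$; $\lambda^\otimes_0=\rho^\bullet_1$; $\lambda^\bullet_{AB}\alpha^\otimes_{0,A,B}=\lambda^\bullet_B(\lambda^\bullet_A\otimes1)$;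 $\rho^\bullet_A(1\otimes\lambda^\bullet_B)\alpha^\otimes_{A,0,B}=\lambda^\bullet_B(\rho^\bullet_A\otimes1)$; $\rho^\bullet_A(1\otimes\rho^\bullet_B)\alpha^\otimes_{A,B,0}=\rho^\bullet_{AB}$; $\lambda^\oplus_{AB}(\rho^\bullet_A\oplus1)\delta^l_{A,0,B}=1\otimes\lambda^\oplus_B$; $\lambda^\oplus_{BA}(\lambda^\bullet_A\oplus1)\delta^r_{0,B,A}=\lambda^\oplus_B\otimes1$; $\rho^\oplus_{AB}(1\oplus\rho^\bullet_A)\delta^l_{A,B,0}=1\otimes\rho^\oplus_B$; $\rho^\oplus_{AB}(1\oplus\lambda^\bullet_B)\delta^r_{A,0,B}=\rho^\oplus_A\otimes1$; $(\lambda^\otimes_A\oplus\lambda^\otimes_B)\delta^l_{1,A,B}=\lambda^\otimes_{A\oplus B}$; $(\rho^\otimes_A\oplus\rho^\otimes_B)\delta^r_{A,B,1}=\rho^\otimes_{A\oplus B}$. It is tight if $\delta^l,\delta^r$ are natural isomorphisms. A braided bimonoidal category is a bimonoidal category with a braiding $\zeta^\otimes$ making $\otimes$ braided monoidal, such that $\delta^l_{C,A,B}\zeta^\otimes_{A\oplus B,C}=(\zeta^\otimes_{A,C}\oplus\zeta^\otimes_{B,C})\delta^r_{A,B,C}$, $\delta^r_{B,C,A}\zeta^\otimes_{A,B\oplus C}=(\zeta^\otimes_{A,B}\oplus\zeta^\otimes_{A,C})\delta^l_{A,B,C}$, $\lambda^\bullet_A\zeta^\otimes_{A,0}=\rho^\bullet_A$,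 and $\rho^\bullet_A\zeta^\otimes_{0,A}=\lambda^\bullet_A$. The bimonoidal Drinfeld center $\overline{C}^{\mathsf{bi}}$ of a tight bimonoidal category $C$. Objects: pairs $(A;\beta^A)$ with $A\in C$ and $\beta^A_X:A\otimes X\to X\otimes A$ a natural isomorphism in $X\in C$ such that for all $X,Y$: $\beta^A_{XY}=(\alpha^\otimes_{X,Y,A})^{-1}(1\otimes\beta^A_Y)\alpha^\otimes_{X,A,Y}(\beta^A_X\otimes1)(\alpha^\otimes_{A,X,Y})^{-1}$, $\ \delta^r_{X,Y,A}\beta^A_{X\oplus Y}=(\beta^A_X\oplus\beta^A_Y)\delta^l_{A,X,Y}$, and $\lambda^\bullet_A\beta^A_0=\rho^\bullet_A$. Morphisms $(A;\beta^A)\to(B;\beta^B)$: morphisms $f:A\to B$ in $C$ with $(1_X\otimes f)\beta^A_X=\beta^B_X(f\otimes1_X)$ for all $X$. Structure: $(A;\beta^A)\oplus(B;\beta^B)=(A\oplus B;\beta)$ with $\beta_X=(\delta^l_{X,A,B})^{-1}(\beta^A_X\oplus\beta^B_X)\delta^r_{A,B,X}$; zero object $(0;(\rho^\bullet)^{-1}\lambda^\bullet)$; $(A;\beta^A)\otimes(B;\beta^B)=(A\otimes B;\beta)$ with $\beta_X=\alpha^\otimes_{X,A,B}(\beta^A_X\otimes1)(\alpha^\otimes_{A,X,B})^{-1}(1\otimes\beta^B_X)\alpha^\otimes_{A,B,X}$; unit $(1;(\rho^\otimes)^{-1}\lambda^\otimes)$; the braiding $(A;\beta^A)\otimes(B;\beta^B)\to(B;\beta^B)\otimes(A;\beta^A)$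 is $\beta^A_B$; all other structure morphisms ($\alpha,\lambda,\rho$ for $\oplus$ and $\otimes$, $\zeta^\oplus$, $\lambda^\bullet$, $\rho^\bullet$, $\delta^l$, $\delta^r$) are those of $C$. *)

theory Defs
  imports "HOL-Library.FuncSet"
begin

section \<open>Categories\<close>

text \<open>
  A category is a set of objects, a family of hom-sets, identities and a composition operation;
  composition is written in applicative order. Hom-sets are not required to be
  disjoint, so every axiom about an arrow mentions the hom-set it is taken from. This allows the
  hom-sets of the Drinfeld center to be subsets of the hom-sets of the original category; a category
  given by a set of arrows with domain and codomain maps is the case of disjoint hom-sets.
\<close>

record ('o, 'm) cat =
  Obj :: "'o set"
  Hom :: "'o \<Rightarrow> 'o \<Rightarrow> 'm set"
  Ident :: "'o \<Rightarrow> 'm"  ("\<i>\<d>\<index>")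
  Comp :: "'m \<Rightarrow> 'm \<Rightarrow> 'm"  (infixr "\<cdot>\<index>" 55)

locale category =
  fixes C :: "('o, 'm, 'z) cat_scheme" (structure)
  assumes hom_obj: "f \<in> Hom C A B \<Longrightarrow> A \<in> Obj C \<and> B \<in> Obj C"
    and id_hom: "A \<in> Obj C \<Longrightarrow> \<i>\<d> A \<in> Hom C A A"
    and comp_hom: "\<lbrakk>f \<in> Hom C A B; g \<in> Hom C B D\<rbrakk> \<Longrightarrow> g \<cdot> f \<in> Hom C A D"
    and comp_id_left: "f \<in> Hom C A B \<Longrightarrow> \<i>\<d> B \<cdot> f = f"
    and comp_id_right: "f \<in> Hom C A B \<Longrightarrow> f \<cdot> \<i>\<d> A = f"
    and comp_assoc: "\<lbrakk>f \<in> Hom C A B; g \<in> Hom C B D; h \<in> Hom C D E\<rbrakk> \<Longrightarrow>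
      (h \<cdot> g) \<cdot> f = h \<cdot> (g \<cdot> f)"

context
  fixes C :: "('o, 'm, 'z) cat_scheme" (structure)
begin

definition inverse_arrows :: "'o \<Rightarrow> 'o \<Rightarrow> 'm \<Rightarrow> 'm \<Rightarrow> bool" where
  "inverse_arrows A B f g \<longleftrightarrow>
     f \<in> Hom C A B \<and> g \<in> Hom C B A \<and> g \<cdot> f = \<i>\<d> A \<and> f \<cdot> g = \<i>\<d> B"

definition iso_arr :: "'o \<Rightarrow> 'o \<Rightarrow> 'm \<Rightarrow> bool" where
  "iso_arr A B f \<longleftrightarrow> (\<exists>g. inverse_arrows A B f g)"

text \<open>The inverse of an isomorphism from \<open>A\<close> to \<open>B\<close>, an arrow from \<open>B\<close> to \<open>A\<close>.\<close>

definition inv_arr :: "'o \<Rightarrow> 'o \<Rightarrow> 'm \<Rightarrow> 'm" where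
  "inv_arr A B f = (THE g. inverse_arrows A B f g)"

definition mono_arr :: "'o \<Rightarrow> 'o \<Rightarrow> 'm \<Rightarrow> bool" where
  "mono_arr A B f \<longleftrightarrow> f \<in> Hom C A B \<and>
     (\<forall>X g h. g \<in> Hom C X A \<longrightarrow> h \<in> Hom C X A \<longrightarrow> f \<cdot> g = f \<cdot> h \<longrightarrow> g = h)"

end

section \<open>Monoidal, braided and symmetric monoidal categories\<close>

text \<open>
  The tensor product of objects is \<open>\<odot>\<close>, that of arrows is \<open>\<star>\<close>. The structure is given by
  parameters besides \<open>C\<close> because a bimonoidal category carries two of them on one category.
\<close>

locale monoidal_category = category +
  fixes tens :: "'o \<Rightarrow> 'o \<Rightarrow> 'o"  (infixr "\<odot>" 70)
    and tens_arr :: "'m \<Rightarrow> 'm \<Rightarrow> 'm"  (infixr "\<star>" 70)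
    and unit :: "'o"  ("\<I>")
    and assoc :: "'o \<Rightarrow> 'o \<Rightarrow> 'o \<Rightarrow> 'm"  ("\<a>")
    and lunit :: "'o \<Rightarrow> 'm"  ("\<l>")
    and runit :: "'o \<Rightarrow> 'm"  ("\<r>")
  assumes tens_obj: "\<lbrakk>A \<in> Obj C; B \<in> Obj C\<rbrakk> \<Longrightarrow> A \<odot> B \<in> Obj C"
    and tens_hom: "\<lbrakk>f \<in> Hom C A A'; g \<in> Hom C B B'\<rbrakk> \<Longrightarrow> f \<star> g \<in> Hom C (A \<odot> B) (A' \<odot> B')"
    and tens_id: "\<lbrakk>A \<in> Obj C; B \<in> Obj C\<rbrakk> \<Longrightarrow> \<i>\<d> A \<star> \<i>\<d> B = \<i>\<d> (A \<odot> B)"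
    and tens_comp: "\<lbrakk>f \<in> Hom C A A'; f' \<in> Hom C A' A''; g \<in> Hom C B B'; g' \<in> Hom C B' B''\<rbrakk> \<Longrightarrow>
      (f' \<cdot> f) \<star> (g' \<cdot> g) = (f' \<star> g') \<cdot> (f \<star> g)"
    and unit_obj: "\<I> \<in> Obj C"
    and assoc_iso: "\<lbrakk>A \<in> Obj C; B \<in> Obj C; D \<in> Obj C\<rbrakk> \<Longrightarrow>
      iso_arr C ((A \<odot> B) \<odot> D) (A \<odot> (B \<odot> D)) (\<a> A B D)"
    and assoc_nat: "\<lbrakk>f \<in> Hom C A A'; g \<in> Hom C B B'; h \<in> Hom C D D'\<rbrakk> \<Longrightarrow>
      \<a> A' B' D' \<cdot> ((f \<star> g) \<star> h) = (f \<star> (g \<star> h)) \<cdot> \<a> A B D"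
    and lunit_iso: "A \<in> Obj C \<Longrightarrow> iso_arr C (\<I> \<odot> A) A (\<l> A)"
    and lunit_nat: "f \<in> Hom C A B \<Longrightarrow> \<l> B \<cdot> (\<i>\<d> \<I> \<star> f) = f \<cdot> \<l> A"
    and runit_iso: "A \<in> Obj C \<Longrightarrow> iso_arr C (A \<odot> \<I>) A (\<r> A)"
    and runit_nat: "f \<in> Hom C A B \<Longrightarrow> \<r> B \<cdot> (f \<star> \<i>\<d> \<I>) = f \<cdot> \<r> A"
    and pentagon: "\<lbrakk>A \<in> Obj C; B \<in> Obj C; D \<in> Obj C; E \<in> Obj C\<rbrakk> \<Longrightarrow>
      (\<i>\<d> A \<star> \<a> B D E) \<cdot> \<a> A (B \<odot> D) E \<cdot> (\<a> A B D \<star> \<i>\<d> E) = \<a> A B (D \<odot> E) \<cdot> \<a> (A \<odot> B) D E"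
    and triangle: "\<lbrakk>A \<in> Obj C; B \<in> Obj C\<rbrakk> \<Longrightarrow>
      (\<i>\<d> A \<star> \<l> B) \<cdot> \<a> A \<I> B = \<r> A \<star> \<i>\<d> B"

locale braided_monoidal_category = monoidal_category +
  fixes braiding :: "'o \<Rightarrow> 'o \<Rightarrow> 'm"  ("\<s>")
  assumes braiding_iso: "\<lbrakk>A \<in> Obj C; B \<in> Obj C\<rbrakk> \<Longrightarrow> iso_arr C (A \<odot> B) (B \<odot> A) (\<s> A B)"
    and braiding_nat: "\<lbrakk>f \<in> Hom C A A'; g \<in> Hom C B B'\<rbrakk> \<Longrightarrow>
      \<s> A' B' \<cdot> (f \<star> g) = (g \<star> f) \<cdot> \<s> A B"
    and hexagon_right: "\<lbrakk>A \<in> Obj C; B \<in> Obj C; D \<in> Obj C\<rbrakk> \<Longrightarrow>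
      \<a> B D A \<cdot> \<s> A (B \<odot> D) \<cdot> \<a> A B D = (\<i>\<d> B \<star> \<s> A D) \<cdot> \<a> B A D \<cdot> (\<s> A B \<star> \<i>\<d> D)"
    and hexagon_left: "\<lbrakk>A \<in> Obj C; B \<in> Obj C; D \<in> Obj C\<rbrakk> \<Longrightarrow>
      inv_arr C ((D \<odot> A) \<odot> B) (D \<odot> (A \<odot> B)) (\<a> D A B) \<cdot> \<s> (A \<odot> B) D
          \<cdot> inv_arr C ((A \<odot> B) \<odot> D) (A \<odot> (B \<odot> D)) (\<a> A B D)
        = (\<s> A D \<star> \<i>\<d> B) \<cdot> inv_arr C ((A \<odot> D) \<odot> B) (A \<odot> (D \<odot> B)) (\<a> A D B)
          \<cdot> (\<i>\<d> A \<star> \<s> B D)"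

locale symmetric_monoidal_category = braided_monoidal_category +
  assumes symmetry: "\<lbrakk>A \<in> Obj C; B \<in> Obj C\<rbrakk> \<Longrightarrow> \<s> B A \<cdot> \<s> A B = \<i>\<d> (A \<odot> B)"

section \<open>Bimonoidal categories\<close>

text \<open>
  \<open>\<oplus>\<close> and \<open>\<otimes>\<close> act on objects, \<open>\<boxplus>\<close> and \<open>\<boxtimes>\<close> are the same functors on arrows.
\<close>

record ('o, 'm) bimonoidal = "('o, 'm) cat" +
  sum_obj :: "'o \<Rightarrow> 'o \<Rightarrow> 'o"  (infixr "\<oplus>\<index>" 65)
  sum_arr :: "'m \<Rightarrow> 'm \<Rightarrow> 'm"  (infixr "\<boxplus>\<index>" 65)
  zero_obj :: "'o"  ("\<zero>\<index>")
  sum_assoc :: "'o \<Rightarrow> 'o \<Rightarrow> 'o \<Rightarrow> 'm"  ("\<alpha>\<^sup>\<oplus>\<index>")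
  sum_lunit :: "'o \<Rightarrow> 'm"  ("\<lambda>\<^sup>\<oplus>\<index>")
  sum_runit :: "'o \<Rightarrow> 'm"  ("\<rho>\<^sup>\<oplus>\<index>")
  sum_sym :: "'o \<Rightarrow> 'o \<Rightarrow> 'm"  ("\<zeta>\<^sup>\<oplus>\<index>")
  prod_obj :: "'o \<Rightarrow> 'o \<Rightarrow> 'o"  (infixr "\<otimes>\<index>" 70)
  prod_arr :: "'m \<Rightarrow> 'm \<Rightarrow> 'm"  (infixr "\<boxtimes>\<index>" 70)
  one_obj :: "'o"  ("\<one>\<index>")
  prod_assoc :: "'o \<Rightarrow> 'o \<Rightarrow> 'o \<Rightarrow> 'm"  ("\<alpha>\<^sup>\<otimes>\<index>")
  prod_lunit :: "'o \<Rightarrow> 'm"  ("\<lambda>\<^sup>\<otimes>\<index>")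
  prod_runit :: "'o \<Rightarrow> 'm"  ("\<rho>\<^sup>\<otimes>\<index>")
  lnull :: "'o \<Rightarrow> 'm"  ("\<lambda>\<^sup>\<bullet>\<index>")
  rnull :: "'o \<Rightarrow> 'm"  ("\<rho>\<^sup>\<bullet>\<index>")
  ldist :: "'o \<Rightarrow> 'o \<Rightarrow> 'o \<Rightarrow> 'm"  ("\<delta>\<^sup>l\<index>")
  rdist :: "'o \<Rightarrow> 'o \<Rightarrow> 'o \<Rightarrow> 'm"  ("\<delta>\<^sup>r\<index>")

text \<open>
  \<open>sum_middle C P Q R S\<close> is the coherence isomorphism
  \<open>(P \<oplus> Q) \<oplus> (R \<oplus> S) \<rightarrow> (P \<oplus> R) \<oplus> (Q \<oplus> S)\<close> exchanging the two middle summands.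
\<close>

definition sum_middle ::
    "('o, 'm, 'z) bimonoidal_scheme \<Rightarrow> 'o \<Rightarrow> 'o \<Rightarrow> 'o \<Rightarrow> 'o \<Rightarrow> 'm"  ("\<mu>\<index>") where
  "\<mu>\<^bsub>C\<^esub> P Q R S =
     inv_arr C ((P \<oplus>\<^bsub>C\<^esub> R) \<oplus>\<^bsub>C\<^esub> (Q \<oplus>\<^bsub>C\<^esub> S)) (P \<oplus>\<^bsub>C\<^esub> (R \<oplus>\<^bsub>C\<^esub> (Q \<oplus>\<^bsub>C\<^esub> S))) (\<alpha>\<^sup>\<oplus>\<^bsub>C\<^esub> P R (Q \<oplus>\<^bsub>C\<^esub> S))
     \<cdot>\<^bsub>C\<^esub> (\<i>\<d>\<^bsub>C\<^esub> P \<boxplus>\<^bsub>C\<^esub>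
        (\<alpha>\<^sup>\<oplus>\<^bsub>C\<^esub> R Q S
         \<cdot>\<^bsub>C\<^esub> (\<zeta>\<^sup>\<oplus>\<^bsub>C\<^esub> Q R \<boxplus>\<^bsub>C\<^esub> \<i>\<d>\<^bsub>C\<^esub> S)
         \<cdot>\<^bsub>C\<^esub> inv_arr C ((Q \<oplus>\<^bsub>C\<^esub> R) \<oplus>\<^bsub>C\<^esub> S) (Q \<oplus>\<^bsub>C\<^esub> (R \<oplus>\<^bsub>C\<^esub> S)) (\<alpha>\<^sup>\<oplus>\<^bsub>C\<^esub> Q R S)))
     \<cdot>\<^bsub>C\<^esub> \<alpha>\<^sup>\<oplus>\<^bsub>C\<^esub> P Q (R \<oplus>\<^bsub>C\<^esub> S)"

locale bimonoidal_category =
  sum: symmetric_monoidal_category C "(\<oplus>)" "(\<boxplus>)" "\<zero>" "\<alpha>\<^sup>\<oplus>" "\<lambda>\<^sup>\<oplus>" "\<rho>\<^sup>\<oplus>" "\<zeta>\<^sup>\<oplus>" +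
  prod: monoidal_category C "(\<otimes>)" "(\<boxtimes>)" "\<one>" "\<alpha>\<^sup>\<otimes>" "\<lambda>\<^sup>\<otimes>" "\<rho>\<^sup>\<otimes>"
  for C :: "('o, 'm, 'z) bimonoidal_scheme" (structure) +
  assumes lnull_iso: "A \<in> Obj C \<Longrightarrow> iso_arr C (\<zero> \<otimes> A) \<zero> (\<lambda>\<^sup>\<bullet> A)"
    and lnull_nat: "f \<in> Hom C A B \<Longrightarrow> \<lambda>\<^sup>\<bullet> B \<cdot> (\<i>\<d> \<zero> \<boxtimes> f) = \<lambda>\<^sup>\<bullet> A"
    and rnull_iso: "A \<in> Obj C \<Longrightarrow> iso_arr C (A \<otimes> \<zero>) \<zero> (\<rho>\<^sup>\<bullet> A)"
    and rnull_nat: "f \<in> Hom C A B \<Longrightarrow> \<rho>\<^sup>\<bullet> B \<cdot> (f \<boxtimes> \<i>\<d> \<zero>) = \<rho>\<^sup>\<bullet> A"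
    and ldist_mono: "\<lbrakk>A \<in> Obj C; B \<in> Obj C; D \<in> Obj C\<rbrakk> \<Longrightarrow>
      mono_arr C (A \<otimes> (B \<oplus> D)) (A \<otimes> B \<oplus> A \<otimes> D) (\<delta>\<^sup>l A B D)"
    and ldist_nat: "\<lbrakk>f \<in> Hom C A A'; g \<in> Hom C B B'; h \<in> Hom C D D'\<rbrakk> \<Longrightarrow>
      \<delta>\<^sup>l A' B' D' \<cdot> (f \<boxtimes> (g \<boxplus> h)) = (f \<boxtimes> g \<boxplus> f \<boxtimes> h) \<cdot> \<delta>\<^sup>l A B D"
    and rdist_mono: "\<lbrakk>A \<in> Obj C; B \<in> Obj C; D \<in> Obj C\<rbrakk> \<Longrightarrow>
      mono_arr C ((A \<oplus> B) \<otimes> D) (A \<otimes> D \<oplus> B \<otimes> D) (\<delta>\<^sup>r A B D)"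
    and rdist_nat: "\<lbrakk>f \<in> Hom C A A'; g \<in> Hom C B B'; h \<in> Hom C D D'\<rbrakk> \<Longrightarrow>
      \<delta>\<^sup>r A' B' D' \<cdot> ((f \<boxplus> g) \<boxtimes> h) = (f \<boxtimes> h \<boxplus> g \<boxtimes> h) \<cdot> \<delta>\<^sup>r A B D"
    and ldist_sym: "\<lbrakk>A \<in> Obj C; B \<in> Obj C; D \<in> Obj C\<rbrakk> \<Longrightarrow>
      \<delta>\<^sup>l A D B \<cdot> (\<i>\<d> A \<boxtimes> \<zeta>\<^sup>\<oplus> B D) = \<zeta>\<^sup>\<oplus> (A \<otimes> B) (A \<otimes> D) \<cdot> \<delta>\<^sup>l A B D"
    and rdist_sym: "\<lbrakk>A \<in> Obj C; B \<in> Obj C; D \<in> Obj C\<rbrakk> \<Longrightarrow>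
      \<delta>\<^sup>r B A D \<cdot> (\<zeta>\<^sup>\<oplus> A B \<boxtimes> \<i>\<d> D) = \<zeta>\<^sup>\<oplus> (A \<otimes> D) (B \<otimes> D) \<cdot> \<delta>\<^sup>r A B D"
    and rdist_sum_assoc: "\<lbrakk>A \<in> Obj C; B \<in> Obj C; D \<in> Obj C; E \<in> Obj C\<rbrakk> \<Longrightarrow>
      \<alpha>\<^sup>\<oplus> (A \<otimes> E) (B \<otimes> E) (D \<otimes> E) \<cdot> (\<delta>\<^sup>r A B E \<boxplus> \<i>\<d> (D \<otimes> E)) \<cdot> \<delta>\<^sup>r (A \<oplus> B) D E
        = (\<i>\<d> (A \<otimes> E) \<boxplus> \<delta>\<^sup>r B D E) \<cdot> \<delta>\<^sup>r A (B \<oplus> D) E \<cdot> (\<alpha>\<^sup>\<oplus> A B D \<boxtimes> \<i>\<d> E)"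
    and ldist_sum_assoc: "\<lbrakk>A \<in> Obj C; B \<in> Obj C; D \<in> Obj C; E \<in> Obj C\<rbrakk> \<Longrightarrow>
      \<alpha>\<^sup>\<oplus> (A \<otimes> B) (A \<otimes> D) (A \<otimes> E) \<cdot> (\<delta>\<^sup>l A B D \<boxplus> \<i>\<d> (A \<otimes> E)) \<cdot> \<delta>\<^sup>l A (B \<oplus> D) E
        = (\<i>\<d> (A \<otimes> B) \<boxplus> \<delta>\<^sup>l A D E) \<cdot> \<delta>\<^sup>l A B (D \<oplus> E) \<cdot> (\<i>\<d> A \<boxtimes> \<alpha>\<^sup>\<oplus> B D E)"
    and ldist_prod_assoc: "\<lbrakk>A \<in> Obj C; B \<in> Obj C; D \<in> Obj C; E \<in> Obj C\<rbrakk> \<Longrightarrow>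
      \<delta>\<^sup>l A (B \<otimes> D) (B \<otimes> E) \<cdot> (\<i>\<d> A \<boxtimes> \<delta>\<^sup>l B D E) \<cdot> \<alpha>\<^sup>\<otimes> A B (D \<oplus> E)
        = (\<alpha>\<^sup>\<otimes> A B D \<boxplus> \<alpha>\<^sup>\<otimes> A B E) \<cdot> \<delta>\<^sup>l (A \<otimes> B) D E"
    and rdist_prod_assoc: "\<lbrakk>A \<in> Obj C; B \<in> Obj C; D \<in> Obj C; E \<in> Obj C\<rbrakk> \<Longrightarrow>
      (\<alpha>\<^sup>\<otimes> A D E \<boxplus> \<alpha>\<^sup>\<otimes> B D E) \<cdot> \<delta>\<^sup>r (A \<otimes> D) (B \<otimes> D) E \<cdot> (\<delta>\<^sup>r A B D \<boxtimes> \<i>\<d> E)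
        = \<delta>\<^sup>r A B (D \<otimes> E) \<cdot> \<alpha>\<^sup>\<otimes> (A \<oplus> B) D E"
    and ldist_rdist_prod_assoc: "\<lbrakk>A \<in> Obj C; B \<in> Obj C; D \<in> Obj C; E \<in> Obj C\<rbrakk> \<Longrightarrow>
      (\<alpha>\<^sup>\<otimes> A B E \<boxplus> \<alpha>\<^sup>\<otimes> A D E) \<cdot> \<delta>\<^sup>r (A \<otimes> B) (A \<otimes> D) E \<cdot> (\<delta>\<^sup>l A B D \<boxtimes> \<i>\<d> E)
        = \<delta>\<^sup>l A (B \<otimes> E) (D \<otimes> E) \<cdot> (\<i>\<d> A \<boxtimes> \<delta>\<^sup>r B D E) \<cdot> \<alpha>\<^sup>\<otimes> A (B \<oplus> D) E"
    and ldist_rdist_middle: "\<lbrakk>A \<in> Obj C; B \<in> Obj C; D \<in> Obj C; E \<in> Obj C\<rbrakk> \<Longrightarrow>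
      \<mu> (A \<otimes> D) (A \<otimes> E) (B \<otimes> D) (B \<otimes> E) \<cdot> (\<delta>\<^sup>l A D E \<boxplus> \<delta>\<^sup>l B D E) \<cdot> \<delta>\<^sup>r A B (D \<oplus> E)
        = (\<delta>\<^sup>r A B D \<boxplus> \<delta>\<^sup>r A B E) \<cdot> \<delta>\<^sup>l (A \<oplus> B) D E"
    and lnull_rnull_zero: "\<lambda>\<^sup>\<bullet> \<zero> = \<rho>\<^sup>\<bullet> \<zero>"
    and lnull_sum: "\<lbrakk>A \<in> Obj C; B \<in> Obj C\<rbrakk> \<Longrightarrow>
      \<lambda>\<^sup>\<oplus> \<zero> \<cdot> (\<lambda>\<^sup>\<bullet> A \<boxplus> \<lambda>\<^sup>\<bullet> B) \<cdot> \<delta>\<^sup>l \<zero> A B = \<lambda>\<^sup>\<bullet> (A \<oplus> B)"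
    and rnull_sum: "\<lbrakk>A \<in> Obj C; B \<in> Obj C\<rbrakk> \<Longrightarrow>
      \<lambda>\<^sup>\<oplus> \<zero> \<cdot> (\<rho>\<^sup>\<bullet> A \<boxplus> \<rho>\<^sup>\<bullet> B) \<cdot> \<delta>\<^sup>r A B \<zero> = \<rho>\<^sup>\<bullet> (A \<oplus> B)"
    and prod_runit_zero: "\<rho>\<^sup>\<otimes> \<zero> = \<lambda>\<^sup>\<bullet> \<one>"
    and prod_lunit_zero: "\<lambda>\<^sup>\<otimes> \<zero> = \<rho>\<^sup>\<bullet> \<one>"
    and lnull_prod: "\<lbrakk>A \<in> Obj C; B \<in> Obj C\<rbrakk> \<Longrightarrow>
      \<lambda>\<^sup>\<bullet> (A \<otimes> B) \<cdot> \<alpha>\<^sup>\<otimes> \<zero> A B = \<lambda>\<^sup>\<bullet> B \<cdot> (\<lambda>\<^sup>\<bullet> A \<boxtimes> \<i>\<d> B)"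
    and null_middle_prod: "\<lbrakk>A \<in> Obj C; B \<in> Obj C\<rbrakk> \<Longrightarrow>
      \<rho>\<^sup>\<bullet> A \<cdot> (\<i>\<d> A \<boxtimes> \<lambda>\<^sup>\<bullet> B) \<cdot> \<alpha>\<^sup>\<otimes> A \<zero> B = \<lambda>\<^sup>\<bullet> B \<cdot> (\<rho>\<^sup>\<bullet> A \<boxtimes> \<i>\<d> B)"
    and rnull_prod: "\<lbrakk>A \<in> Obj C; B \<in> Obj C\<rbrakk> \<Longrightarrow>
      \<rho>\<^sup>\<bullet> A \<cdot> (\<i>\<d> A \<boxtimes> \<rho>\<^sup>\<bullet> B) \<cdot> \<alpha>\<^sup>\<otimes> A B \<zero> = \<rho>\<^sup>\<bullet> (A \<otimes> B)"
    and ldist_zero_left: "\<lbrakk>A \<in> Obj C; B \<in> Obj C\<rbrakk> \<Longrightarrow>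
      \<lambda>\<^sup>\<oplus> (A \<otimes> B) \<cdot> (\<rho>\<^sup>\<bullet> A \<boxplus> \<i>\<d> (A \<otimes> B)) \<cdot> \<delta>\<^sup>l A \<zero> B = \<i>\<d> A \<boxtimes> \<lambda>\<^sup>\<oplus> B"
    and rdist_zero_left: "\<lbrakk>A \<in> Obj C; B \<in> Obj C\<rbrakk> \<Longrightarrow>
      \<lambda>\<^sup>\<oplus> (B \<otimes> A) \<cdot> (\<lambda>\<^sup>\<bullet> A \<boxplus> \<i>\<d> (B \<otimes> A)) \<cdot> \<delta>\<^sup>r \<zero> B A = \<lambda>\<^sup>\<oplus> B \<boxtimes> \<i>\<d> A"
    and ldist_zero_right: "\<lbrakk>A \<in> Obj C; B \<in> Obj C\<rbrakk> \<Longrightarrow>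
      \<rho>\<^sup>\<oplus> (A \<otimes> B) \<cdot> (\<i>\<d> (A \<otimes> B) \<boxplus> \<rho>\<^sup>\<bullet> A) \<cdot> \<delta>\<^sup>l A B \<zero> = \<i>\<d> A \<boxtimes> \<rho>\<^sup>\<oplus> B"
    and rdist_zero_right: "\<lbrakk>A \<in> Obj C; B \<in> Obj C\<rbrakk> \<Longrightarrow>
      \<rho>\<^sup>\<oplus> (A \<otimes> B) \<cdot> (\<i>\<d> (A \<otimes> B) \<boxplus> \<lambda>\<^sup>\<bullet> B) \<cdot> \<delta>\<^sup>r A \<zero> B = \<rho>\<^sup>\<oplus> A \<boxtimes> \<i>\<d> B"
    and prod_lunit_sum: "\<lbrakk>A \<in> Obj C; B \<in> Obj C\<rbrakk> \<Longrightarrow>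
      (\<lambda>\<^sup>\<otimes> A \<boxplus> \<lambda>\<^sup>\<otimes> B) \<cdot> \<delta>\<^sup>l \<one> A B = \<lambda>\<^sup>\<otimes> (A \<oplus> B)"
    and prod_runit_sum: "\<lbrakk>A \<in> Obj C; B \<in> Obj C\<rbrakk> \<Longrightarrow>
      (\<rho>\<^sup>\<otimes> A \<boxplus> \<rho>\<^sup>\<otimes> B) \<cdot> \<delta>\<^sup>r A B \<one> = \<rho>\<^sup>\<otimes> (A \<oplus> B)"

locale tight_bimonoidal_category = bimonoidal_category +
  assumes ldist_iso: "\<lbrakk>A \<in> Obj C; B \<in> Obj C; D \<in> Obj C\<rbrakk> \<Longrightarrow>
      iso_arr C (A \<otimes> (B \<oplus> D)) (A \<otimes> B \<oplus> A \<otimes> D) (\<delta>\<^sup>l A B D)"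
    and rdist_iso: "\<lbrakk>A \<in> Obj C; B \<in> Obj C; D \<in> Obj C\<rbrakk> \<Longrightarrow>
      iso_arr C ((A \<oplus> B) \<otimes> D) (A \<otimes> D \<oplus> B \<otimes> D) (\<delta>\<^sup>r A B D)"

record ('o, 'm) braided_bimonoidal = "('o, 'm) bimonoidal" +
  prod_braid :: "'o \<Rightarrow> 'o \<Rightarrow> 'm"  ("\<zeta>\<^sup>\<otimes>\<index>")

locale braided_bimonoidal_category =
  bimonoidal_category C +
  prod: braided_monoidal_category C "(\<otimes>)" "(\<boxtimes>)" "\<one>" "\<alpha>\<^sup>\<otimes>" "\<lambda>\<^sup>\<otimes>" "\<rho>\<^sup>\<otimes>" "\<zeta>\<^sup>\<otimes>"
  for C :: "('o, 'm, 'z) braided_bimonoidal_scheme" (structure) +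
  assumes ldist_braid: "\<lbrakk>A \<in> Obj C; B \<in> Obj C; D \<in> Obj C\<rbrakk> \<Longrightarrow>
      \<delta>\<^sup>l D A B \<cdot> \<zeta>\<^sup>\<otimes> (A \<oplus> B) D = (\<zeta>\<^sup>\<otimes> A D \<boxplus> \<zeta>\<^sup>\<otimes> B D) \<cdot> \<delta>\<^sup>r A B D"
    and rdist_braid: "\<lbrakk>A \<in> Obj C; B \<in> Obj C; D \<in> Obj C\<rbrakk> \<Longrightarrow>
      \<delta>\<^sup>r B D A \<cdot> \<zeta>\<^sup>\<otimes> A (B \<oplus> D) = (\<zeta>\<^sup>\<otimes> A B \<boxplus> \<zeta>\<^sup>\<otimes> A D) \<cdot> \<delta>\<^sup>l A B D"
    and lnull_braid: "A \<in> Obj C \<Longrightarrow> \<lambda>\<^sup>\<bullet> A \<cdot> \<zeta>\<^sup>\<otimes> A \<zero> = \<rho>\<^sup>\<bullet> A"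
    and rnull_braid: "A \<in> Obj C \<Longrightarrow> \<rho>\<^sup>\<bullet> A \<cdot> \<zeta>\<^sup>\<otimes> \<zero> A = \<lambda>\<^sup>\<bullet> A"

locale tight_braided_bimonoidal_category =
  tight_bimonoidal_category C + braided_bimonoidal_category C
  for C :: "('o, 'm, 'z) braided_bimonoidal_scheme" (structure)

section \<open>The bimonoidal Drinfeld center\<close>

context
  fixes C :: "('o, 'm, 'z) bimonoidal_scheme" (structure)
begin

text \<open>
  A half braiding is a family of arrows indexed by the objects of \<open>C\<close>; it is represented by a
  function with the fixed value \<open>undefined\<close> off \<open>Obj C\<close>, so that two families agreeing on all objects
  are equal.
\<close>

definition half_braiding :: "'o \<Rightarrow> ('o \<Rightarrow> 'm) \<Rightarrow> bool" where
  "half_braiding A \<beta> \<longleftrightarrow>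
     \<beta> \<in> extensional (Obj C) \<and>
     (\<forall>X\<in>Obj C. iso_arr C (A \<otimes> X) (X \<otimes> A) (\<beta> X)) \<and>
     (\<forall>X Y. \<forall>f\<in>Hom C X Y. \<beta> Y \<cdot> (\<i>\<d> A \<boxtimes> f) = (f \<boxtimes> \<i>\<d> A) \<cdot> \<beta> X) \<and>
     (\<forall>X\<in>Obj C. \<forall>Y\<in>Obj C. \<beta> (X \<otimes> Y) =
        inv_arr C ((X \<otimes> Y) \<otimes> A) (X \<otimes> (Y \<otimes> A)) (\<alpha>\<^sup>\<otimes> X Y A)
        \<cdot> (\<i>\<d> X \<boxtimes> \<beta> Y) \<cdot> \<alpha>\<^sup>\<otimes> X A Y \<cdot> (\<beta> X \<boxtimes> \<i>\<d> Y)
        \<cdot> inv_arr C ((A \<otimes> X) \<otimes> Y) (A \<otimes> (X \<otimes> Y)) (\<alpha>\<^sup>\<otimes> A X Y)) \<and>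
     (\<forall>X\<in>Obj C. \<forall>Y\<in>Obj C. \<delta>\<^sup>r X Y A \<cdot> \<beta> (X \<oplus> Y) = (\<beta> X \<boxplus> \<beta> Y) \<cdot> \<delta>\<^sup>l A X Y) \<and>
     \<lambda>\<^sup>\<bullet> A \<cdot> \<beta> \<zero> = \<rho>\<^sup>\<bullet> A"

definition center_obj :: "('o \<times> ('o \<Rightarrow> 'm)) set" where
  "center_obj = {(A, \<beta>). A \<in> Obj C \<and> half_braiding A \<beta>}"

definition center_hom :: "'o \<times> ('o \<Rightarrow> 'm) \<Rightarrow> 'o \<times> ('o \<Rightarrow> 'm) \<Rightarrow> 'm set" where
  "center_hom = (\<lambda>(A, \<beta>) (B, \<gamma>). {f \<in> Hom C A B.
     (A, \<beta>) \<in> center_obj \<and> (B, \<gamma>) \<in> center_obj \<and>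
     (\<forall>X\<in>Obj C. (\<i>\<d> X \<boxtimes> f) \<cdot> \<beta> X = \<gamma> X \<cdot> (f \<boxtimes> \<i>\<d> X))})"

definition center_sum :: "'o \<times> ('o \<Rightarrow> 'm) \<Rightarrow> 'o \<times> ('o \<Rightarrow> 'm) \<Rightarrow> 'o \<times> ('o \<Rightarrow> 'm)" where
  "center_sum = (\<lambda>(A, \<beta>) (B, \<gamma>). (A \<oplus> B,
     \<lambda>X\<in>Obj C. inv_arr C (X \<otimes> (A \<oplus> B)) (X \<otimes> A \<oplus> X \<otimes> B) (\<delta>\<^sup>l X A B)
       \<cdot> (\<beta> X \<boxplus> \<gamma> X) \<cdot> \<delta>\<^sup>r A B X))"

definition center_zero :: "'o \<times> ('o \<Rightarrow> 'm)" where
  "center_zero = (\<zero>, \<lambda>X\<in>Obj C. inv_arr C (X \<otimes> \<zero>) \<zero> (\<rho>\<^sup>\<bullet> X) \<cdot> \<lambda>\<^sup>\<bullet> X)"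

definition center_prod :: "'o \<times> ('o \<Rightarrow> 'm) \<Rightarrow> 'o \<times> ('o \<Rightarrow> 'm) \<Rightarrow> 'o \<times> ('o \<Rightarrow> 'm)" where
  "center_prod = (\<lambda>(A, \<beta>) (B, \<gamma>). (A \<otimes> B,
     \<lambda>X\<in>Obj C. \<alpha>\<^sup>\<otimes> X A B \<cdot> (\<beta> X \<boxtimes> \<i>\<d> B)
       \<cdot> inv_arr C ((A \<otimes> X) \<otimes> B) (A \<otimes> (X \<otimes> B)) (\<alpha>\<^sup>\<otimes> A X B)
       \<cdot> (\<i>\<d> A \<boxtimes> \<gamma> X) \<cdot> \<alpha>\<^sup>\<otimes> A B X))"

definition center_one :: "'o \<times> ('o \<Rightarrow> 'm)" where
  "center_one = (\<one>, \<lambda>X\<in>Obj C. inv_arr C (X \<otimes> \<one>) X (\<rho>\<^sup>\<otimes> X) \<cdot> \<lambda>\<^sup>\<otimes> X)"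

definition bimonoidal_Drinfeld_center :: "('o \<times> ('o \<Rightarrow> 'm), 'm) braided_bimonoidal" where
  "bimonoidal_Drinfeld_center = \<lparr>
     Obj = center_obj,
     Hom = center_hom,
     Ident = (\<lambda>(A, _). \<i>\<d> A),
     Comp = (\<cdot>),
     sum_obj = center_sum,
     sum_arr = (\<boxplus>),
     zero_obj = center_zero,
     sum_assoc = (\<lambda>(A, _) (B, _) (D, _). \<alpha>\<^sup>\<oplus> A B D),
     sum_lunit = (\<lambda>(A, _). \<lambda>\<^sup>\<oplus> A),
     sum_runit = (\<lambda>(A, _). \<rho>\<^sup>\<oplus> A),
     sum_sym = (\<lambda>(A, _) (B, _). \<zeta>\<^sup>\<oplus> A B),
     prod_obj = center_prod,
     prod_arr = (\<boxtimes>),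
     one_obj = center_one,
     prod_assoc = (\<lambda>(A, _) (B, _) (D, _). \<alpha>\<^sup>\<otimes> A B D),
     prod_lunit = (\<lambda>(A, _). \<lambda>\<^sup>\<otimes> A),
     prod_runit = (\<lambda>(A, _). \<rho>\<^sup>\<otimes> A),
     lnull = (\<lambda>(A, _). \<lambda>\<^sup>\<bullet> A),
     rnull = (\<lambda>(A, _). \<rho>\<^sup>\<bullet> A),
     ldist = (\<lambda>(A, _) (B, _) (D, _). \<delta>\<^sup>l A B D),
     rdist = (\<lambda>(A, _) (B, _) (D, _). \<delta>\<^sup>r A B D),
     prod_braid = (\<lambda>(A, \<beta>) (B, _). \<beta> B)\<rparr>"

end

end

theory Submission
  imports Defs
begin

text \<open>
  A half braiding on \<open>A\<close> is a natural isomorphism \<open>A \<otimes> X \<rightarrow> X \<otimes> A\<close> that is compatible with \<open>\<otimes>\<close>, \<open>\<oplus>\<close>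
  and \<open>\<zero>\<close> in the variable \<open>X\<close>. Composition, the two functors on arrows and the structure arrows other
  than the braiding are taken over from \<open>C\<close>, and the inverse of an arrow of the center is again an arrow
  of the center. Hence every equation of a tight bimonoidal category that holds in \<open>C\<close> holds in the center
  as well, as soon as both sides make sense there. What has to be shown is that they do.

  The sum, the product, the zero and the unit of half braidings must be half braidings
  (\<open>half_braided_sum\<close>, \<open>half_braided_prod\<close>, \<open>half_braided_zero\<close>, \<open>half_braided_one\<close>). The structure
  arrows must commute with the half braidings of their source and target (the lemmas \<open>center_mor_\<dots>\<close>).
  Both kinds of statement are proved by pasting squares. The half braiding of a composite
  object is a composite of associators, distributors, their inverses and the given half braidings. A
  distributor, say, is moved past each factor in turn: past an associator or another distributor by a coherence
  axiom of \<open>C\<close> with one variable set to \<open>X\<close>, and past a given half braiding by naturality. For instance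
  \<open>\<delta>\<^sup>l\<close> passes the half braiding of \<open>A \<otimes> (B \<oplus> D)\<close> by two uses of the axiom relating \<open>\<delta>\<^sup>l\<close> to \<open>\<alpha>\<^sup>\<otimes>\<close> and
  one of the axiom relating \<open>\<delta>\<^sup>l\<close>, \<open>\<delta>\<^sup>r\<close> and \<open>\<alpha>\<^sup>\<otimes>\<close>. Two facts are needed beyond the axioms. That the sum of half braidings is
  compatible with \<open>\<oplus>\<close> rests on the exchange of the middle summands being natural and
  its own inverse (\<open>Middle_natural\<close>, \<open>Middle_Middle\<close>). For the unit, the identities
  \<open>\<lambda> \<alpha> = \<lambda> \<otimes> 1\<close> and \<open>(1 \<otimes> \<rho>) \<alpha> = \<rho>\<close> of Kelly are needed (\<open>Lunit_tens\<close>, \<open>Runit_tens\<close>).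

  That the braiding is an arrow of the center is the naturality of a half braiding in an arrow that is itself
  a component of a half braiding (\<open>center_mor_braiding\<close>). Its axioms are then at hand. The first hexagon is the compatibility of a half braiding with \<open>\<otimes>\<close>,
  and the second is the definition of the product of half braidings. The axioms relating the braiding to the distributors and
  to the zero are the compatibility of a half braiding with \<open>\<oplus>\<close> and \<open>\<zero>\<close> and the definitions of the sum and of
  the zero half braiding.

  Since hom-sets need not be disjoint, an arrow of \<open>C\<close> does not know its source and target, and every use of associativity
  would need them to be supplied by hand. The diagrams are therefore chased with arrows that carry their
  source and target. Then the typing conditions are computed by rewriting, and oriented coherence
  axioms push a distributor or an associator to the right through a whole composite. Structure arrows in this form have
  capitalised names (\<open>Assoc\<close>, \<open>Ldist\<close>, and so on).
\<close>

section \<open>Arrows with source and target\<close>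

datatype ('o, 'm) arrow = Arrow (src: 'o) (mor: 'm) (tgt: 'o)

context category
begin

definition arr :: "('o, 'm) arrow \<Rightarrow> bool"
  where "arr f \<longleftrightarrow> mor f \<in> Hom C (src f) (tgt f)"

definition acomp :: "('o, 'm) arrow \<Rightarrow> ('o, 'm) arrow \<Rightarrow> ('o, 'm) arrow"  (infixr "\<bullet>" 55)
  where "g \<bullet> f = Arrow (src f) (mor g \<cdot> mor f) (tgt g)"

definition aid :: "'o \<Rightarrow> ('o, 'm) arrow"  ("\<iota>")
  where "\<iota> A = Arrow A (\<i>\<d> A) A"

definition is_iso :: "('o, 'm) arrow \<Rightarrow> bool"
  where "is_iso f \<longleftrightarrow> iso_arr C (src f) (tgt f) (mor f)"

definition inv_of :: "('o, 'm) arrow \<Rightarrow> ('o, 'm) arrow"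
  where "inv_of f = Arrow (tgt f) (inv_arr C (src f) (tgt f) (mor f)) (src f)"

lemma acomp_simps [simp]: "src (g \<bullet> f) = src f" "tgt (g \<bullet> f) = tgt g"
  by (simp_all add: acomp_def)

lemma aid_simps [simp]: "src (\<iota> A) = A" "tgt (\<iota> A) = A"
  by (simp_all add: aid_def)

lemma inv_simps [simp]: "src (inv_of f) = tgt f" "tgt (inv_of f) = src f"
  by (simp_all add: inv_of_def)

lemma arr_obj [simp]: "arr f \<Longrightarrow> src f \<in> Obj C" "arr f \<Longrightarrow> tgt f \<in> Obj C"
  using hom_obj unfolding arr_def by blast+

lemma arr_aid [simp]: "A \<in> Obj C \<Longrightarrow> arr (\<iota> A)"
  by (simp add: arr_def aid_def id_hom)

lemma arr_acomp [simp]: "\<lbrakk>arr g; arr f; src g = tgt f\<rbrakk> \<Longrightarrow> arr (g \<bullet> f)"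
  using comp_hom by (simp add: arr_def acomp_def)

lemma acomp_assoc [simp]:
  "\<lbrakk>arr h; arr g; arr f; src h = tgt g; src g = tgt f\<rbrakk> \<Longrightarrow> (h \<bullet> g) \<bullet> f = h \<bullet> g \<bullet> f"
  using comp_assoc by (simp add: arr_def acomp_def)

lemma aid_left [simp]: "\<lbrakk>arr f; tgt f = A\<rbrakk> \<Longrightarrow> \<iota> A \<bullet> f = f"
  using comp_id_left by (cases f) (auto simp add: arr_def acomp_def aid_def)

lemma aid_right [simp]: "\<lbrakk>arr f; src f = A\<rbrakk> \<Longrightarrow> f \<bullet> \<iota> A = f"
  using comp_id_right by (cases f) (auto simp add: arr_def acomp_def aid_def)

lemma inverse_arrows_unique:
  assumes "inverse_arrows C A B f g" "inverse_arrows C A B f h"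
  shows "g = h"
proof -
  have *: "f \<in> Hom C A B" "g \<in> Hom C B A" "h \<in> Hom C B A" "g \<cdot> f = \<i>\<d> A" "f \<cdot> h = \<i>\<d> B"
    using assms by (simp_all add: inverse_arrows_def)
  have "g = g \<cdot> (f \<cdot> h)" using * comp_id_right by simp
  also have "\<dots> = (g \<cdot> f) \<cdot> h" using *(1-3) by (simp only: comp_assoc)
  also have "\<dots> = h" using * comp_id_left by simp
  finally show ?thesis .
qed

lemma inv_arr_eq: "inverse_arrows C A B f g \<Longrightarrow> inv_arr C A B f = g"
  unfolding inv_arr_def using inverse_arrows_unique by blast

lemma inverse_arrows_inv_arr: "iso_arr C A B f \<Longrightarrow> inverse_arrows C A B f (inv_arr C A B f)"
  unfolding iso_arr_def using inv_arr_eq by metis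

lemma is_iso_arr [simp]: "is_iso f \<Longrightarrow> arr f"
  by (auto simp add: is_iso_def iso_arr_def inverse_arrows_def arr_def)

lemma arr_inv [simp]: "is_iso f \<Longrightarrow> arr (inv_of f)"
  using inverse_arrows_inv_arr by (simp add: is_iso_def inv_of_def inverse_arrows_def arr_def)

lemma inv_comp [simp]: "is_iso f \<Longrightarrow> inv_of f \<bullet> f = \<iota> (src f)" "is_iso f \<Longrightarrow> f \<bullet> inv_of f = \<iota> (tgt f)"
  using inverse_arrows_inv_arr[of "src f" "tgt f" "mor f"]
  by (auto simp add: is_iso_def inv_of_def inverse_arrows_def acomp_def aid_def)

lemma isoI:
  assumes "arr f" "arr g" "src f = tgt g" "tgt f = src g" "g \<bullet> f = \<iota> (src f)" "f \<bullet> g = \<iota> (tgt f)"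
  shows "is_iso f" and "inv_of f = g"
proof -
  have *: "inverse_arrows C (src f) (tgt f) (mor f) (mor g)"
    using assms by (simp add: arr_def acomp_def aid_def inverse_arrows_def)
  then show "is_iso f" by (auto simp add: is_iso_def iso_arr_def)
  show "inv_of f = g" using inv_arr_eq[OF *] assms by (cases g) (simp add: inv_of_def)
qed

lemma inv_comp_cancel [simp]:
  "\<lbrakk>is_iso f; arr k; tgt k = src f\<rbrakk> \<Longrightarrow> inv_of f \<bullet> f \<bullet> k = k"
  "\<lbrakk>is_iso f; arr k; tgt k = tgt f\<rbrakk> \<Longrightarrow> f \<bullet> inv_of f \<bullet> k = k"
  using acomp_assoc[of "inv_of f" f k] acomp_assoc[of f "inv_of f" k] by auto

lemma iso_aid [simp]: "A \<in> Obj C \<Longrightarrow> is_iso (\<iota> A)"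
  by (rule isoI[of _ "\<iota> A"]) auto

lemma inv_aid [simp]: "A \<in> Obj C \<Longrightarrow> inv_of (\<iota> A) = \<iota> A"
  by (rule isoI) auto

lemma iso_inv [simp]: "is_iso f \<Longrightarrow> is_iso (inv_of f)"
  by (rule isoI[of _ f]) auto

lemma iso_acomp [simp]: "\<lbrakk>is_iso g; is_iso f; src g = tgt f\<rbrakk> \<Longrightarrow> is_iso (g \<bullet> f)"
  by (rule isoI[of _ "inv_of f \<bullet> inv_of g"]) auto

lemma iso_cancel_left: "\<lbrakk>h \<bullet> f = h \<bullet> g; is_iso h; arr f; arr g; src h = tgt f; src h = tgt g\<rbrakk> \<Longrightarrow> f = g"
  by (metis inv_comp_cancel(1))

lemma iso_cancel_right:
  assumes "f \<bullet> h = g \<bullet> h" "is_iso h" "arr f" "arr g" "src f = tgt h" "src g = tgt h"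
  shows "f = g"
proof -
  have "(f \<bullet> h) \<bullet> inv_of h = (g \<bullet> h) \<bullet> inv_of h" using assms by simp
  then show ?thesis using assms(2-) by simp
qed

lemma square_inv:
  assumes "v \<bullet> f = g \<bullet> u" "is_iso f" "is_iso g" "arr u" "arr v" "src v = tgt f" "src g = tgt u"
  shows "u \<bullet> inv_of f = inv_of g \<bullet> v"
proof -
  have "src u = src f" "tgt v = tgt g" using arg_cong[OF assms(1), of src] arg_cong[OF assms(1), of tgt] by auto
  then have "inv_of g \<bullet> (v \<bullet> f) \<bullet> inv_of f = inv_of g \<bullet> (g \<bullet> u) \<bullet> inv_of f" using assms(1) by simp
  then show ?thesis using assms(2-) \<open>src u = src f\<close> \<open>tgt v = tgt g\<close> by simp
qed

text \<open>
  Composites are kept associated to the right, so an equation between composites applies in the middle of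
  a path only in the form with a tail \<open>k\<close>. These two rules produce that form from the bare equation.
\<close>

lemma comp_extend:
  "\<lbrakk>g \<bullet> f = h; arr g; arr f; src g = tgt f; arr k; tgt k = src f\<rbrakk> \<Longrightarrow> g \<bullet> f \<bullet> k = h \<bullet> k"
  using acomp_assoc by auto

lemma comp_extend3:
  "\<lbrakk>g \<bullet> f \<bullet> e = h; arr g; arr f; arr e; src g = tgt f; src f = tgt e; arr k; tgt k = src e\<rbrakk>
    \<Longrightarrow> g \<bullet> f \<bullet> e \<bullet> k = h \<bullet> k"
  using comp_extend[of g "f \<bullet> e" h k] by simp

lemma square_inv_vertical:
  assumes "v \<bullet> f = g \<bullet> u" "is_iso u" "is_iso v" "arr f" "arr g" "src v = tgt f" "src g = tgt u"
  shows "inv_of v \<bullet> g = f \<bullet> inv_of u"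
proof -
  have "src u = src f" "tgt v = tgt g" using arg_cong[OF assms(1), of src] arg_cong[OF assms(1), of tgt] by auto
  then have "inv_of v \<bullet> (v \<bullet> f) \<bullet> inv_of u = inv_of v \<bullet> (g \<bullet> u) \<bullet> inv_of u" using assms(1) by simp
  then show ?thesis using assms(2-) \<open>src u = src f\<close> \<open>tgt v = tgt g\<close> by simp
qed

end

section \<open>Monoidal categories\<close>

context monoidal_category
begin

definition atens :: "('o, 'm) arrow \<Rightarrow> ('o, 'm) arrow \<Rightarrow> ('o, 'm) arrow"  (infixr "\<Otimes>" 70)
  where "f \<Otimes> g = Arrow (src f \<odot> src g) (mor f \<star> mor g) (tgt f \<odot> tgt g)"

definition Assoc where "Assoc A B D = Arrow ((A \<odot> B) \<odot> D) (\<a> A B D) (A \<odot> (B \<odot> D))"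
definition Lunit where "Lunit A = Arrow (\<I> \<odot> A) (\<l> A) A"
definition Runit where "Runit A = Arrow (A \<odot> \<I>) (\<r> A) A"

lemma structure_simps [simp]:
  "src (f \<Otimes> g) = src f \<odot> src g" "tgt (f \<Otimes> g) = tgt f \<odot> tgt g"
  "src (Assoc A B D) = (A \<odot> B) \<odot> D" "tgt (Assoc A B D) = A \<odot> (B \<odot> D)"
  "src (Lunit A) = \<I> \<odot> A" "tgt (Lunit A) = A"
  "src (Runit A) = A \<odot> \<I>" "tgt (Runit A) = A"
  by (simp_all add: atens_def Assoc_def Lunit_def Runit_def)

lemma obj_simps [simp]: "\<I> \<in> Obj C" "\<lbrakk>A \<in> Obj C; B \<in> Obj C\<rbrakk> \<Longrightarrow> A \<odot> B \<in> Obj C"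
  by (simp_all add: unit_obj tens_obj)

lemma structure_iso [simp]:
  "\<lbrakk>A \<in> Obj C; B \<in> Obj C; D \<in> Obj C\<rbrakk> \<Longrightarrow> is_iso (Assoc A B D)"
  "A \<in> Obj C \<Longrightarrow> is_iso (Lunit A)"  "A \<in> Obj C \<Longrightarrow> is_iso (Runit A)"
  by (simp_all add: is_iso_def Assoc_def Lunit_def Runit_def assoc_iso lunit_iso runit_iso)

lemma arr_tens [simp]: "\<lbrakk>arr f; arr g\<rbrakk> \<Longrightarrow> arr (f \<Otimes> g)"
  by (simp add: arr_def atens_def tens_hom)

lemma aid_tens [simp]: "\<lbrakk>A \<in> Obj C; B \<in> Obj C\<rbrakk> \<Longrightarrow> \<iota> A \<Otimes> \<iota> B = \<iota> (A \<odot> B)"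
  by (simp add: aid_def atens_def tens_id)

lemma comp_tens:
  "\<lbrakk>arr f; arr f'; arr g; arr g'; src f' = tgt f; src g' = tgt g\<rbrakk> \<Longrightarrow>
     (f' \<bullet> f) \<Otimes> (g' \<bullet> g) = (f' \<Otimes> g') \<bullet> (f \<Otimes> g)"
  by (simp add: arr_def acomp_def atens_def tens_comp)

lemma whisker_left [simp]:
  "\<lbrakk>A \<in> Obj C; arr g; arr f; src g = tgt f\<rbrakk> \<Longrightarrow> \<iota> A \<Otimes> (g \<bullet> f) = (\<iota> A \<Otimes> g) \<bullet> (\<iota> A \<Otimes> f)"
  using comp_tens[of "\<iota> A" "\<iota> A" f g] by simp

lemma whisker_right [simp]:
  "\<lbrakk>A \<in> Obj C; arr g; arr f; src g = tgt f\<rbrakk> \<Longrightarrow> (g \<bullet> f) \<Otimes> \<iota> A = (g \<Otimes> \<iota> A) \<bullet> (f \<Otimes> \<iota> A)"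
  using comp_tens[of f g "\<iota> A" "\<iota> A"] by simp

lemma tens_tens:
  "\<lbrakk>arr f; arr f'; arr g; arr g'; src f' = tgt f; src g' = tgt g\<rbrakk> \<Longrightarrow>
     (f' \<Otimes> g') \<bullet> (f \<Otimes> g) = (f' \<bullet> f) \<Otimes> (g' \<bullet> g)"
  "\<lbrakk>arr f; arr f'; arr g; arr g'; src f' = tgt f; src g' = tgt g; arr k; tgt k = src f \<odot> src g\<rbrakk> \<Longrightarrow>
     (f' \<Otimes> g') \<bullet> (f \<Otimes> g) \<bullet> k = ((f' \<bullet> f) \<Otimes> (g' \<bullet> g)) \<bullet> k"
  by (simp_all add: comp_tens)

text \<open>
  The premises are equations between composites, so that rewriting finds inverse pairs at any depth of
  whiskering.
\<close>

lemma tens_cancel [simp]: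
  "\<lbrakk>f' \<bullet> f = \<iota> (src f); g' \<bullet> g = \<iota> (src g); arr f; arr f'; arr g; arr g'; src f' = tgt f; src g' = tgt g\<rbrakk> \<Longrightarrow>
     (f' \<Otimes> g') \<bullet> (f \<Otimes> g) = \<iota> (src f \<odot> src g)"
  "\<lbrakk>f' \<bullet> f = \<iota> (src f); g' \<bullet> g = \<iota> (src g); arr f; arr f'; arr g; arr g'; src f' = tgt f; src g' = tgt g;
    arr k; tgt k = src f \<odot> src g\<rbrakk> \<Longrightarrow>
     (f' \<Otimes> g') \<bullet> (f \<Otimes> g) \<bullet> k = k"
  by (simp_all add: tens_tens)

lemma iso_tens [simp]: "\<lbrakk>is_iso f; is_iso g\<rbrakk> \<Longrightarrow> is_iso (f \<Otimes> g)"
  by (rule isoI[of _ "inv_of f \<Otimes> inv_of g"]) auto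

lemma inv_tens [simp]: "\<lbrakk>is_iso f; is_iso g\<rbrakk> \<Longrightarrow> inv_of (f \<Otimes> g) = inv_of f \<Otimes> inv_of g"
  by (rule isoI) auto

lemma whisker_eq_left: "\<lbrakk>f \<bullet> g = h; arr f; arr g; src f = tgt g; A \<in> Obj C\<rbrakk> \<Longrightarrow> (\<iota> A \<Otimes> f) \<bullet> (\<iota> A \<Otimes> g) = \<iota> A \<Otimes> h"
  using whisker_left[of A f g] by simp

lemma whisker_eq_right: "\<lbrakk>f \<bullet> g = h; arr f; arr g; src f = tgt g; A \<in> Obj C\<rbrakk> \<Longrightarrow> (f \<Otimes> \<iota> A) \<bullet> (g \<Otimes> \<iota> A) = h \<Otimes> \<iota> A"
  using whisker_right[of A f g] by simp

lemma whisker_swap: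
  "\<lbrakk>arr f; arr g; A = tgt f; B = src g\<rbrakk> \<Longrightarrow> (\<iota> A \<Otimes> g) \<bullet> (f \<Otimes> \<iota> B) = (f \<Otimes> \<iota> (tgt g)) \<bullet> (\<iota> (src f) \<Otimes> g)"
  by (simp add: tens_tens)

lemma Assoc_natural:
  "\<lbrakk>arr f; arr g; arr h; tgt f = A; tgt g = B; tgt h = D\<rbrakk> \<Longrightarrow>
    Assoc A B D \<bullet> (f \<Otimes> g) \<Otimes> h = (f \<Otimes> g \<Otimes> h) \<bullet> Assoc (src f) (src g) (src h)"
  by (auto simp add: arr_def acomp_def atens_def Assoc_def assoc_nat)

lemma Lunit_natural: "\<lbrakk>arr f; tgt f = B\<rbrakk> \<Longrightarrow> Lunit B \<bullet> (\<iota> \<I> \<Otimes> f) = f \<bullet> Lunit (src f)"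
  by (auto simp add: arr_def acomp_def atens_def Lunit_def lunit_nat aid_def)

lemma Runit_natural: "\<lbrakk>arr f; tgt f = B\<rbrakk> \<Longrightarrow> Runit B \<bullet> (f \<Otimes> \<iota> \<I>) = f \<bullet> Runit (src f)"
  by (auto simp add: arr_def acomp_def atens_def Runit_def runit_nat aid_def)

lemma Pentagon:
  "\<lbrakk>A \<in> Obj C; B \<in> Obj C; D \<in> Obj C; E \<in> Obj C\<rbrakk> \<Longrightarrow>
    (\<iota> A \<Otimes> Assoc B D E) \<bullet> Assoc A (B \<odot> D) E \<bullet> (Assoc A B D \<Otimes> \<iota> E)
      = Assoc A B (D \<odot> E) \<bullet> Assoc (A \<odot> B) D E"
  by (simp add: acomp_def atens_def Assoc_def aid_def pentagon)

lemma Triangle: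
  "\<lbrakk>A \<in> Obj C; B \<in> Obj C\<rbrakk> \<Longrightarrow> (\<iota> A \<Otimes> Lunit B) \<bullet> Assoc A \<I> B = Runit A \<Otimes> \<iota> B"
  by (simp add: acomp_def atens_def Assoc_def aid_def Lunit_def Runit_def triangle)

text \<open>
  Since \<open>\<iota> A \<Otimes> \<iota> B\<close> is rewritten to \<open>\<iota> (A \<odot> B)\<close>, the general naturality rule does not match
  an arrow whiskered by a product object.
\<close>

lemma Assoc_natural_right:
  assumes "A \<in> Obj C" "B \<in> Obj C" "arr h" "tgt h = D"
  shows "Assoc A B D \<bullet> \<iota> (A \<odot> B) \<Otimes> h = (\<iota> A \<Otimes> \<iota> B \<Otimes> h) \<bullet> Assoc A B (src h)"
  using assms Assoc_natural[of "\<iota> A" "\<iota> B" h A B D] by simp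

lemma inv_Assoc_natural:
  assumes "arr f" "arr g" "arr h" "tgt f = A" "tgt g = B" "tgt h = D"
  shows "inv_of (Assoc A B D) \<bullet> (f \<Otimes> g \<Otimes> h) = ((f \<Otimes> g) \<Otimes> h) \<bullet> inv_of (Assoc (src f) (src g) (src h))"
  by (rule square_inv[symmetric]) (use assms Assoc_natural in auto)

text \<open>
  The pentagon solved for the combinations of associators and inverse associators that arise in a product
  of half braidings.
\<close>

context
  fixes A B D E
  assumes obj [simp]: "A \<in> Obj C" "B \<in> Obj C" "D \<in> Obj C" "E \<in> Obj C"
begin

lemma Pentagon1:
  "Assoc (A \<odot> B) D E \<bullet> (inv_of (Assoc A B D) \<Otimes> \<iota> E)
    = inv_of (Assoc A B (D \<odot> E)) \<bullet> (\<iota> A \<Otimes> Assoc B D E) \<bullet> Assoc A (B \<odot> D) E"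
  using arg_cong[OF Pentagon[OF obj], of "\<lambda>h. inv_of (Assoc A B (D \<odot> E)) \<bullet> h \<bullet> (inv_of (Assoc A B D) \<Otimes> \<iota> E)"]
  by simp

lemma Pentagon2:
  "Assoc A (B \<odot> D) E \<bullet> (Assoc A B D \<Otimes> \<iota> E)
    = (\<iota> A \<Otimes> inv_of (Assoc B D E)) \<bullet> Assoc A B (D \<odot> E) \<bullet> Assoc (A \<odot> B) D E"
  using arg_cong[OF Pentagon[OF obj], of "\<lambda>h. (\<iota> A \<Otimes> inv_of (Assoc B D E)) \<bullet> h"]
  by simp

lemma Pentagon3:
  "inv_of (Assoc A B (D \<odot> E)) \<bullet> (\<iota> A \<Otimes> Assoc B D E)
    = Assoc (A \<odot> B) D E \<bullet> (inv_of (Assoc A B D) \<Otimes> \<iota> E) \<bullet> inv_of (Assoc A (B \<odot> D) E)"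
  using arg_cong[OF Pentagon[OF obj], of "\<lambda>h. inv_of (Assoc A B (D \<odot> E)) \<bullet> h \<bullet> (inv_of (Assoc A B D) \<Otimes> \<iota> E) \<bullet> inv_of (Assoc A (B \<odot> D) E)"]
  by simp

lemma Pentagon4:
  "inv_of (Assoc A (B \<odot> D) E) \<bullet> (\<iota> A \<Otimes> inv_of (Assoc B D E)) \<bullet> Assoc A B (D \<odot> E)
    = (Assoc A B D \<Otimes> \<iota> E) \<bullet> inv_of (Assoc (A \<odot> B) D E)"
  using arg_cong[OF Pentagon2, of "\<lambda>h. inv_of (Assoc A (B \<odot> D) E) \<bullet> h \<bullet> inv_of (Assoc (A \<odot> B) D E)"]
  by simp

end

text \<open>
  Tensoring with the unit is faithful because it is naturally isomorphic to the identity functor.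
\<close>

lemma whisker_unit_left_cancel:
  assumes "\<iota> \<I> \<Otimes> f = \<iota> \<I> \<Otimes> g" "arr f" "arr g" "src f = src g" "tgt f = tgt g"
  shows "f = g"
proof (rule iso_cancel_right)
  show "f \<bullet> Lunit (src f) = g \<bullet> Lunit (src f)"
    using assms Lunit_natural[of f "tgt f"] Lunit_natural[of g "tgt f"] by simp
qed (use assms in simp_all)

lemma whisker_unit_right_cancel:
  assumes "f \<Otimes> \<iota> \<I> = g \<Otimes> \<iota> \<I>" "arr f" "arr g" "src f = src g" "tgt f = tgt g"
  shows "f = g"
proof (rule iso_cancel_right)
  show "f \<bullet> Runit (src f) = g \<bullet> Runit (src f)"
    using assms Runit_natural[of f "tgt f"] Runit_natural[of g "tgt f"] by simp
qed (use assms in simp_all)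

text \<open>
  Kelly's argument: it suffices to compare the two sides after whiskering with \<open>\<I>\<close> and precomposing with
  the associators in \<open>?p\<close>. Then the pentagon and the triangle axiom apply to one side, and the triangle
  axiom and naturality of \<open>Assoc\<close> to the other.
\<close>

lemma Lunit_tens:
  assumes [simp]: "A \<in> Obj C" "B \<in> Obj C"
  shows "Lunit (A \<odot> B) \<bullet> Assoc \<I> A B = Lunit A \<Otimes> \<iota> B"
proof (rule whisker_unit_left_cancel)
  let ?p = "Assoc \<I> (\<I> \<odot> A) B \<bullet> (Assoc \<I> \<I> A \<Otimes> \<iota> B)"
  have "(\<iota> \<I> \<Otimes> (Lunit (A \<odot> B) \<bullet> Assoc \<I> A B)) \<bullet> ?p
      = (\<iota> \<I> \<Otimes> Lunit (A \<odot> B)) \<bullet> Assoc \<I> \<I> (A \<odot> B) \<bullet> Assoc (\<I> \<odot> \<I>) A B"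
    using Pentagon[of \<I> \<I> A B] by simp
  also have "\<dots> = (Runit \<I> \<Otimes> \<iota> (A \<odot> B)) \<bullet> Assoc (\<I> \<odot> \<I>) A B"
    using arg_cong[OF Triangle[of \<I> "A \<odot> B"], of "\<lambda>h. h \<bullet> Assoc (\<I> \<odot> \<I>) A B"] by simp
  also have "\<dots> = Assoc \<I> A B \<bullet> ((Runit \<I> \<Otimes> \<iota> A) \<Otimes> \<iota> B)"
    using Assoc_natural[of "Runit \<I>" "\<iota> A" "\<iota> B" \<I> A B] by simp
  also have "\<dots> = Assoc \<I> A B \<bullet> ((\<iota> \<I> \<Otimes> Lunit A) \<Otimes> \<iota> B) \<bullet> (Assoc \<I> \<I> A \<Otimes> \<iota> B)"
    by (simp flip: Triangle)
  also have "\<dots> = (\<iota> \<I> \<Otimes> Lunit A \<Otimes> \<iota> B) \<bullet> ?p"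
    using arg_cong[OF Assoc_natural[of "\<iota> \<I>" "Lunit A" "\<iota> B" \<I> A B], of "\<lambda>h. h \<bullet> (Assoc \<I> \<I> A \<Otimes> \<iota> B)"]
    by simp
  finally show "\<iota> \<I> \<Otimes> (Lunit (A \<odot> B) \<bullet> Assoc \<I> A B) = \<iota> \<I> \<Otimes> Lunit A \<Otimes> \<iota> B"
    by (rule iso_cancel_right) simp_all
qed simp_all

lemma Runit_tens:
  assumes [simp]: "A \<in> Obj C" "B \<in> Obj C"
  shows "(\<iota> A \<Otimes> Runit B) \<bullet> Assoc A B \<I> = Runit (A \<odot> B)"
proof (rule whisker_unit_right_cancel)
  have "Assoc A B \<I> \<bullet> (((\<iota> A \<Otimes> Runit B) \<bullet> Assoc A B \<I>) \<Otimes> \<iota> \<I>)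
      = (\<iota> A \<Otimes> (Runit B \<Otimes> \<iota> \<I>)) \<bullet> Assoc A (B \<odot> \<I>) \<I> \<bullet> (Assoc A B \<I> \<Otimes> \<iota> \<I>)"
    using arg_cong[OF Assoc_natural[of "\<iota> A" "Runit B" "\<iota> \<I>" A B \<I>], of "\<lambda>h. h \<bullet> (Assoc A B \<I> \<Otimes> \<iota> \<I>)"]
    by simp
  also have "\<dots> = (\<iota> A \<Otimes> \<iota> B \<Otimes> Lunit \<I>) \<bullet> (\<iota> A \<Otimes> Assoc B \<I> \<I>) \<bullet> Assoc A (B \<odot> \<I>) \<I> \<bullet> (Assoc A B \<I> \<Otimes> \<iota> \<I>)"
    by (simp flip: Triangle)
  also have "\<dots> = (\<iota> A \<Otimes> \<iota> B \<Otimes> Lunit \<I>) \<bullet> Assoc A B (\<I> \<odot> \<I>) \<bullet> Assoc (A \<odot> B) \<I> \<I>"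
    by (simp add: Pentagon)
  also have "\<dots> = Assoc A B \<I> \<bullet> (\<iota> (A \<odot> B) \<Otimes> Lunit \<I>) \<bullet> Assoc (A \<odot> B) \<I> \<I>"
    using arg_cong[OF Assoc_natural_right[of A B "Lunit \<I>" \<I>], of "\<lambda>h. h \<bullet> Assoc (A \<odot> B) \<I> \<I>"]
    by simp
  also have "\<dots> = Assoc A B \<I> \<bullet> (Runit (A \<odot> B) \<Otimes> \<iota> \<I>)"
    by (simp add: Triangle)
  finally show "((\<iota> A \<Otimes> Runit B) \<bullet> Assoc A B \<I>) \<Otimes> \<iota> \<I> = Runit (A \<odot> B) \<Otimes> \<iota> \<I>"
    by (rule iso_cancel_left) simp_all
qed simp_all

end

section \<open>Symmetry and the exchange of the middle summands\<close>

context braided_monoidal_category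
begin

definition Braid where "Braid A B = Arrow (A \<odot> B) (\<s> A B) (B \<odot> A)"

lemma Braid_simps [simp]: "src (Braid A B) = A \<odot> B" "tgt (Braid A B) = B \<odot> A"
  by (simp_all add: Braid_def)

lemma iso_Braid [simp]: "\<lbrakk>A \<in> Obj C; B \<in> Obj C\<rbrakk> \<Longrightarrow> is_iso (Braid A B)"
  by (simp add: is_iso_def Braid_def braiding_iso)

lemma Braid_natural:
  "\<lbrakk>arr f; arr g; tgt f = A; tgt g = B\<rbrakk> \<Longrightarrow> Braid A B \<bullet> (f \<Otimes> g) = (g \<Otimes> f) \<bullet> Braid (src f) (src g)"
  by (auto simp add: arr_def acomp_def atens_def Braid_def braiding_nat)

end

context symmetric_monoidal_category
begin

lemma Braid_Braid [simp]: "\<lbrakk>A \<in> Obj C; B \<in> Obj C\<rbrakk> \<Longrightarrow> Braid B A \<bullet> Braid A B = \<iota> (A \<odot> B)"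
  by (simp add: acomp_def Braid_def aid_def symmetry)

definition Middle where
  "Middle P Q R S = inv_of (Assoc P R (Q \<odot> S))
     \<bullet> (\<iota> P \<Otimes> (Assoc R Q S \<bullet> (Braid Q R \<Otimes> \<iota> S) \<bullet> inv_of (Assoc Q R S))) \<bullet> Assoc P Q (R \<odot> S)"

lemma Middle_simps [simp]:
  "src (Middle P Q R S) = (P \<odot> Q) \<odot> (R \<odot> S)" "tgt (Middle P Q R S) = (P \<odot> R) \<odot> (Q \<odot> S)"
  by (simp_all add: Middle_def)

lemma iso_Middle [simp]:
  "\<lbrakk>P \<in> Obj C; Q \<in> Obj C; R \<in> Obj C; S \<in> Obj C\<rbrakk> \<Longrightarrow> is_iso (Middle P Q R S)"
  unfolding Middle_def by (intro iso_acomp iso_tens) simp_all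

lemma Middle_Middle:
  "\<lbrakk>P \<in> Obj C; Q \<in> Obj C; R \<in> Obj C; S \<in> Obj C\<rbrakk> \<Longrightarrow>
    Middle P R Q S \<bullet> Middle P Q R S = \<iota> ((P \<odot> Q) \<odot> (R \<odot> S))"
  by (simp add: Middle_def)

lemma Middle_natural:
  assumes "arr f" "arr g" "arr h" "arr l" "tgt f = P" "tgt g = Q" "tgt h = R" "tgt l = S"
  shows "Middle P Q R S \<bullet> ((f \<Otimes> g) \<Otimes> (h \<Otimes> l))
     = ((f \<Otimes> h) \<Otimes> (g \<Otimes> l)) \<bullet> Middle (src f) (src g) (src h) (src l)"
proof -
  let ?m = "\<lambda>Q R S. Assoc R Q S \<bullet> (Braid Q R \<Otimes> \<iota> S) \<bullet> inv_of (Assoc Q R S)"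
  have [simp]: "P \<in> Obj C" "Q \<in> Obj C" "R \<in> Obj C" "S \<in> Obj C"
    using assms(1-4)[THEN arr_obj(2)] assms(5-) by simp_all
  have inner: "?m Q R S \<bullet> (g \<Otimes> h \<Otimes> l) = (h \<Otimes> g \<Otimes> l) \<bullet> ?m (src g) (src h) (src l)"
  proof -
    have "?m Q R S \<bullet> (g \<Otimes> h \<Otimes> l) = Assoc R Q S \<bullet> (Braid Q R \<Otimes> \<iota> S) \<bullet> ((g \<Otimes> h) \<Otimes> l)
        \<bullet> inv_of (Assoc (src g) (src h) (src l))"
      using assms by (simp add: inv_Assoc_natural)
    also have "\<dots> = Assoc R Q S \<bullet> ((h \<Otimes> g) \<Otimes> l) \<bullet> (Braid (src g) (src h) \<Otimes> \<iota> (src l))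
        \<bullet> inv_of (Assoc (src g) (src h) (src l))"
      using assms by (simp add: tens_tens Braid_natural)
    also have "\<dots> = (h \<Otimes> g \<Otimes> l) \<bullet> ?m (src g) (src h) (src l)"
      using assms arg_cong[OF Assoc_natural[of h g l R Q S],
        of "\<lambda>k. k \<bullet> (Braid (src g) (src h) \<Otimes> \<iota> (src l)) \<bullet> inv_of (Assoc (src g) (src h) (src l))"]
      by simp
    finally show ?thesis .
  qed
  let ?i = "\<iota> P \<Otimes> ?m Q R S" and ?i' = "\<iota> (src f) \<Otimes> ?m (src g) (src h) (src l)"
  have inner': "?i \<bullet> (f \<Otimes> (g \<Otimes> h \<Otimes> l)) = (f \<Otimes> (h \<Otimes> g \<Otimes> l)) \<bullet> ?i'"
    using assms inner by (simp add: tens_tens del: whisker_left)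
  have "Middle P Q R S \<bullet> ((f \<Otimes> g) \<Otimes> (h \<Otimes> l)) = inv_of (Assoc P R (Q \<odot> S)) \<bullet> (?i
      \<bullet> (f \<Otimes> (g \<Otimes> h \<Otimes> l))) \<bullet> Assoc (src f) (src g) (src h \<odot> src l)"
    using assms by (simp add: Middle_def Assoc_natural del: whisker_left)
  also have "\<dots> = (inv_of (Assoc P R (Q \<odot> S)) \<bullet> (f \<Otimes> (h \<Otimes> g \<Otimes> l))) \<bullet> ?i' \<bullet> Assoc (src f) (src g) (src h \<odot> src l)"
    unfolding inner' using assms by (simp del: whisker_left)
  also have "\<dots> = ((f \<Otimes> h) \<Otimes> (g \<Otimes> l)) \<bullet> Middle (src f) (src g) (src h) (src l)"
    unfolding Middle_def using assms by (subst inv_Assoc_natural) (simp_all del: whisker_left)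
  finally show ?thesis .
qed

end

section \<open>The axioms of a tight bimonoidal category\<close>

context tight_bimonoidal_category
begin

notation sum.atens (infixr "\<Oplus>" 65)
notation prod.atens (infixr "\<Otimes>" 70)

abbreviation "arr \<equiv> sum.arr"
abbreviation "is_iso \<equiv> sum.is_iso"
abbreviation "inv_of \<equiv> sum.inv_of"

definition "Lnull A = Arrow (\<zero> \<otimes> A) (\<lambda>\<^sup>\<bullet> A) \<zero>"
definition "Rnull A = Arrow (A \<otimes> \<zero>) (\<rho>\<^sup>\<bullet> A) \<zero>"
definition "Ldist A B D = Arrow (A \<otimes> (B \<oplus> D)) (\<delta>\<^sup>l A B D) (A \<otimes> B \<oplus> A \<otimes> D)"
definition "Rdist A B D = Arrow ((A \<oplus> B) \<otimes> D) (\<delta>\<^sup>r A B D) (A \<otimes> D \<oplus> B \<otimes> D)"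

lemma dist_simps [simp]:
  "src (Lnull A) = \<zero> \<otimes> A" "tgt (Lnull A) = \<zero>"
  "src (Rnull A) = A \<otimes> \<zero>" "tgt (Rnull A) = \<zero>"
  "src (Ldist A B D) = A \<otimes> (B \<oplus> D)" "tgt (Ldist A B D) = A \<otimes> B \<oplus> A \<otimes> D"
  "src (Rdist A B D) = (A \<oplus> B) \<otimes> D" "tgt (Rdist A B D) = A \<otimes> D \<oplus> B \<otimes> D"
  by (simp_all add: Lnull_def Rnull_def Ldist_def Rdist_def)

lemma dist_iso [simp]:
  "A \<in> Obj C \<Longrightarrow> is_iso (Lnull A)" "A \<in> Obj C \<Longrightarrow> is_iso (Rnull A)"
  "\<lbrakk>A \<in> Obj C; B \<in> Obj C; D \<in> Obj C\<rbrakk> \<Longrightarrow> is_iso (Ldist A B D)"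
  "\<lbrakk>A \<in> Obj C; B \<in> Obj C; D \<in> Obj C\<rbrakk> \<Longrightarrow> is_iso (Rdist A B D)"
  by (simp_all add: sum.is_iso_def Lnull_def Rnull_def Ldist_def Rdist_def lnull_iso rnull_iso ldist_iso rdist_iso)

lemmas lift_defs = sum.acomp_def sum.aid_def sum.atens_def prod.atens_def sum.Assoc_def prod.Assoc_def
  sum.Lunit_def prod.Lunit_def sum.Runit_def prod.Runit_def sum.Braid_def
  Lnull_def Rnull_def Ldist_def Rdist_def

lemma Lnull_natural: "\<lbrakk>arr f; tgt f = B\<rbrakk> \<Longrightarrow> Lnull B \<bullet> (\<iota> \<zero> \<Otimes> f) = Lnull (src f)"
  using lnull_nat by (auto simp add: sum.arr_def lift_defs)

lemma Rnull_natural: "\<lbrakk>arr f; tgt f = B\<rbrakk> \<Longrightarrow> Rnull B \<bullet> (f \<Otimes> \<iota> \<zero>) = Rnull (src f)"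
  using rnull_nat by (auto simp add: sum.arr_def lift_defs)

lemma Ldist_natural:
  "\<lbrakk>arr f; arr g; arr h; tgt f = A; tgt g = B; tgt h = D\<rbrakk> \<Longrightarrow>
    Ldist A B D \<bullet> (f \<Otimes> (g \<Oplus> h)) = (f \<Otimes> g \<Oplus> f \<Otimes> h) \<bullet> Ldist (src f) (src g) (src h)"
  using ldist_nat by (auto simp add: sum.arr_def lift_defs)

lemma Rdist_natural:
  "\<lbrakk>arr f; arr g; arr h; tgt f = A; tgt g = B; tgt h = D\<rbrakk> \<Longrightarrow>
    Rdist A B D \<bullet> ((f \<Oplus> g) \<Otimes> h) = (f \<Otimes> h \<Oplus> g \<Otimes> h) \<bullet> Rdist (src f) (src g) (src h)"
  using rdist_nat by (auto simp add: sum.arr_def lift_defs)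

lemma Ldist_natural_left:
  "\<lbrakk>arr f; B \<in> Obj C; D \<in> Obj C; tgt f = A\<rbrakk> \<Longrightarrow>
    Ldist A B D \<bullet> (f \<Otimes> \<iota> (B \<oplus> D)) = (f \<Otimes> \<iota> B \<Oplus> f \<Otimes> \<iota> D) \<bullet> Ldist (src f) B D"
  using Ldist_natural[of f "\<iota> B" "\<iota> D" A B D] by simp

lemma Rdist_natural_right:
  "\<lbrakk>A \<in> Obj C; B \<in> Obj C; arr h; tgt h = D\<rbrakk> \<Longrightarrow>
    Rdist A B D \<bullet> (\<iota> (A \<oplus> B) \<Otimes> h) = (\<iota> A \<Otimes> h \<Oplus> \<iota> B \<Otimes> h) \<bullet> Rdist A B (src h)"
  using Rdist_natural[of "\<iota> A" "\<iota> B" h A B D] by simp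

context
  fixes A B
  assumes obj [simp]: "A \<in> Obj C" "B \<in> Obj C"
begin

lemma Lnull_sum: "sum.Lunit \<zero> \<bullet> (Lnull A \<Oplus> Lnull B) \<bullet> Ldist \<zero> A B = Lnull (A \<oplus> B)"
  by (simp add: lift_defs lnull_sum)

lemma Rnull_sum: "sum.Lunit \<zero> \<bullet> (Rnull A \<Oplus> Rnull B) \<bullet> Rdist A B \<zero> = Rnull (A \<oplus> B)"
  by (simp add: lift_defs rnull_sum)

lemma Lnull_prod: "Lnull (A \<otimes> B) \<bullet> prod.Assoc \<zero> A B = Lnull B \<bullet> (Lnull A \<Otimes> \<iota> B)"
  by (simp add: lift_defs lnull_prod)

lemma null_middle:
  "Rnull A \<bullet> (\<iota> A \<Otimes> Lnull B) \<bullet> prod.Assoc A \<zero> B = Lnull B \<bullet> (Rnull A \<Otimes> \<iota> B)"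
  by (simp add: lift_defs null_middle_prod)

lemma Rnull_prod: "Rnull A \<bullet> (\<iota> A \<Otimes> Rnull B) \<bullet> prod.Assoc A B \<zero> = Rnull (A \<otimes> B)"
  by (simp add: lift_defs rnull_prod)

lemma Ldist_zero_left:
  "sum.Lunit (A \<otimes> B) \<bullet> (Rnull A \<Oplus> \<iota> (A \<otimes> B)) \<bullet> Ldist A \<zero> B = \<iota> A \<Otimes> sum.Lunit B"
  by (simp add: lift_defs ldist_zero_left)

lemma Rdist_zero_left:
  "sum.Lunit (B \<otimes> A) \<bullet> (Lnull A \<Oplus> \<iota> (B \<otimes> A)) \<bullet> Rdist \<zero> B A = sum.Lunit B \<Otimes> \<iota> A"
  by (simp add: lift_defs rdist_zero_left)

lemma Ldist_zero_right:
  "sum.Runit (A \<otimes> B) \<bullet> (\<iota> (A \<otimes> B) \<Oplus> Rnull A) \<bullet> Ldist A B \<zero> = \<iota> A \<Otimes> sum.Runit B"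
  by (simp add: lift_defs ldist_zero_right)

lemma Rdist_zero_right:
  "sum.Runit (A \<otimes> B) \<bullet> (\<iota> (A \<otimes> B) \<Oplus> Lnull B) \<bullet> Rdist A \<zero> B = sum.Runit A \<Otimes> \<iota> B"
  by (simp add: lift_defs rdist_zero_right)

lemma Lunit_sum: "(prod.Lunit A \<Oplus> prod.Lunit B) \<bullet> Ldist \<one> A B = prod.Lunit (A \<oplus> B)"
  by (simp add: lift_defs prod_lunit_sum)

lemma Runit_sum: "(prod.Runit A \<Oplus> prod.Runit B) \<bullet> Rdist A B \<one> = prod.Runit (A \<oplus> B)"
  by (simp add: lift_defs prod_runit_sum)

end

context
  fixes A B D
  assumes obj [simp]: "A \<in> Obj C" "B \<in> Obj C" "D \<in> Obj C"
begin

lemma Ldist_sym: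
  "Ldist A D B \<bullet> (\<iota> A \<Otimes> sum.Braid B D) = sum.Braid (A \<otimes> B) (A \<otimes> D) \<bullet> Ldist A B D"
  by (simp add: lift_defs ldist_sym)

lemma Rdist_sym:
  "Rdist B A D \<bullet> (sum.Braid A B \<Otimes> \<iota> D) = sum.Braid (A \<otimes> D) (B \<otimes> D) \<bullet> Rdist A B D"
  by (simp add: lift_defs rdist_sym)

end

context
  fixes A B D E
  assumes obj [simp]: "A \<in> Obj C" "B \<in> Obj C" "D \<in> Obj C" "E \<in> Obj C"
begin

lemma Rdist_sum_assoc:
  "sum.Assoc (A \<otimes> E) (B \<otimes> E) (D \<otimes> E) \<bullet> (Rdist A B E \<Oplus> \<iota> (D \<otimes> E)) \<bullet> Rdist (A \<oplus> B) D E
    = (\<iota> (A \<otimes> E) \<Oplus> Rdist B D E) \<bullet> Rdist A (B \<oplus> D) E \<bullet> (sum.Assoc A B D \<Otimes> \<iota> E)"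
  by (simp add: lift_defs rdist_sum_assoc)

lemma Ldist_sum_assoc:
  "sum.Assoc (A \<otimes> B) (A \<otimes> D) (A \<otimes> E) \<bullet> (Ldist A B D \<Oplus> \<iota> (A \<otimes> E)) \<bullet> Ldist A (B \<oplus> D) E
    = (\<iota> (A \<otimes> B) \<Oplus> Ldist A D E) \<bullet> Ldist A B (D \<oplus> E) \<bullet> (\<iota> A \<Otimes> sum.Assoc B D E)"
  by (simp add: lift_defs ldist_sum_assoc)

lemma Ldist_prod_assoc:
  "Ldist A (B \<otimes> D) (B \<otimes> E) \<bullet> (\<iota> A \<Otimes> Ldist B D E) \<bullet> prod.Assoc A B (D \<oplus> E)
    = (prod.Assoc A B D \<Oplus> prod.Assoc A B E) \<bullet> Ldist (A \<otimes> B) D E"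
  by (simp add: lift_defs ldist_prod_assoc)

lemma Rdist_prod_assoc:
  "(prod.Assoc A D E \<Oplus> prod.Assoc B D E) \<bullet> Rdist (A \<otimes> D) (B \<otimes> D) E \<bullet> (Rdist A B D \<Otimes> \<iota> E)
    = Rdist A B (D \<otimes> E) \<bullet> prod.Assoc (A \<oplus> B) D E"
  by (simp add: lift_defs rdist_prod_assoc)

lemma Ldist_Rdist_prod_assoc:
  "(prod.Assoc A B E \<Oplus> prod.Assoc A D E) \<bullet> Rdist (A \<otimes> B) (A \<otimes> D) E \<bullet> (Ldist A B D \<Otimes> \<iota> E)
    = Ldist A (B \<otimes> E) (D \<otimes> E) \<bullet> (\<iota> A \<Otimes> Rdist B D E) \<bullet> prod.Assoc A (B \<oplus> D) E"
  by (simp add: lift_defs ldist_rdist_prod_assoc)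

lemma Ldist_Rdist_middle:
  "sum.Middle (A \<otimes> D) (A \<otimes> E) (B \<otimes> D) (B \<otimes> E) \<bullet> (Ldist A D E \<Oplus> Ldist B D E) \<bullet> Rdist A B (D \<oplus> E)
    = (Rdist A B D \<Oplus> Rdist A B E) \<bullet> Ldist (A \<oplus> B) D E"
  using ldist_rdist_middle[OF obj]
  by (simp add: lift_defs sum.Middle_def sum_middle_def sum.inv_of_def del: sum.whisker_left)

end

lemma Lnull_Rnull_zero: "Lnull \<zero> = Rnull \<zero>"
  by (simp add: lift_defs lnull_rnull_zero)

lemma Runit_zero: "prod.Runit \<zero> = Lnull \<one>"
  by (simp add: lift_defs prod_runit_zero)

lemma Lunit_zero: "prod.Lunit \<zero> = Rnull \<one>"
  by (simp add: lift_defs prod_lunit_zero)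

end

section \<open>Half braidings\<close>

locale half_braided = tight_bimonoidal_category C
  for C :: "('o, 'm, 'z) bimonoidal_scheme" (structure) +
  fixes A :: 'o and a :: "'o \<Rightarrow> ('o, 'm) arrow"
  assumes hb_obj [simp]: "A \<in> Obj C"
    and hb_src [simp]: "X \<in> Obj C \<Longrightarrow> src (a X) = A \<otimes> X"
    and hb_tgt [simp]: "X \<in> Obj C \<Longrightarrow> tgt (a X) = X \<otimes> A"
    and hb_iso [simp]: "X \<in> Obj C \<Longrightarrow> is_iso (a X)"
    and hb_natural: "\<lbrakk>arr f; tgt f = Y\<rbrakk> \<Longrightarrow> a Y \<bullet> (\<iota> A \<Otimes> f) = (f \<Otimes> \<iota> A) \<bullet> a (src f)"
    and hb_prod: "\<lbrakk>X \<in> Obj C; Y \<in> Obj C\<rbrakk> \<Longrightarrow> a (X \<otimes> Y) = inv_of (prod.Assoc X Y A) \<bullet> (\<iota> X \<Otimes> a Y)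
      \<bullet> prod.Assoc X A Y \<bullet> (a X \<Otimes> \<iota> Y) \<bullet> inv_of (prod.Assoc A X Y)"
    and hb_sum: "\<lbrakk>X \<in> Obj C; Y \<in> Obj C\<rbrakk> \<Longrightarrow> Rdist X Y A \<bullet> a (X \<oplus> Y) = (a X \<Oplus> a Y) \<bullet> Ldist A X Y"
    and hb_null: "Lnull A \<bullet> a \<zero> = Rnull A"

context tight_bimonoidal_category
begin

text \<open>
  The coherence axioms between distributors and associators, solved for inverse associators. They are oriented so that
  distributors travel to the right.
\<close>

lemma Ldist_inv_assoc:
  assumes [simp]: "A \<in> Obj C" "B \<in> Obj C" "D \<in> Obj C" "E \<in> Obj C"
  shows "Ldist (A \<otimes> B) D E \<bullet> inv_of (prod.Assoc A B (D \<oplus> E))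
    = (inv_of (prod.Assoc A B D) \<Oplus> inv_of (prod.Assoc A B E)) \<bullet> Ldist A (B \<otimes> D) (B \<otimes> E) \<bullet> (\<iota> A \<Otimes> Ldist B D E)"
proof -
  have "Ldist (A \<otimes> B) D E
    = (inv_of (prod.Assoc A B D) \<Oplus> inv_of (prod.Assoc A B E)) \<bullet> (prod.Assoc A B D \<Oplus> prod.Assoc A B E) \<bullet> Ldist (A \<otimes> B) D E"
    by simp
  also have "\<dots> = (inv_of (prod.Assoc A B D) \<Oplus> inv_of (prod.Assoc A B E)) \<bullet>
     Ldist A (B \<otimes> D) (B \<otimes> E) \<bullet> (\<iota> A \<Otimes> Ldist B D E) \<bullet> prod.Assoc A B (D \<oplus> E)"
    by (simp only: Ldist_prod_assoc assms)
  finally show ?thesis by simp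
qed

lemma Rdist_inv_assoc:
  assumes [simp]: "A \<in> Obj C" "B \<in> Obj C" "D \<in> Obj C" "E \<in> Obj C"
  shows "Rdist (A \<otimes> D) (B \<otimes> D) E \<bullet> (Rdist A B D \<Otimes> \<iota> E) \<bullet> inv_of (prod.Assoc (A \<oplus> B) D E)
    = (inv_of (prod.Assoc A D E) \<Oplus> inv_of (prod.Assoc B D E)) \<bullet> Rdist A B (D \<otimes> E)"
proof -
  have "Rdist (A \<otimes> D) (B \<otimes> D) E \<bullet> (Rdist A B D \<Otimes> \<iota> E)
    = (inv_of (prod.Assoc A D E) \<Oplus> inv_of (prod.Assoc B D E)) \<bullet> (prod.Assoc A D E \<Oplus> prod.Assoc B D E)
       \<bullet> Rdist (A \<otimes> D) (B \<otimes> D) E \<bullet> (Rdist A B D \<Otimes> \<iota> E)"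
    by simp
  also have "\<dots> = (inv_of (prod.Assoc A D E) \<Oplus> inv_of (prod.Assoc B D E)) \<bullet> Rdist A B (D \<otimes> E) \<bullet> prod.Assoc (A \<oplus> B) D E"
    by (simp only: Rdist_prod_assoc assms)
  finally have "(Rdist (A \<otimes> D) (B \<otimes> D) E \<bullet> (Rdist A B D \<Otimes> \<iota> E)) \<bullet> inv_of (prod.Assoc (A \<oplus> B) D E)
    = ((inv_of (prod.Assoc A D E) \<Oplus> inv_of (prod.Assoc B D E)) \<bullet> Rdist A B (D \<otimes> E) \<bullet> prod.Assoc (A \<oplus> B) D E)
      \<bullet> inv_of (prod.Assoc (A \<oplus> B) D E)" by simp
  then show ?thesis by simp
qed

lemma Rdist_Ldist_inv_assoc:
  assumes [simp]: "A \<in> Obj C" "B \<in> Obj C" "D \<in> Obj C" "E \<in> Obj C"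
  shows "Rdist (A \<otimes> B) (A \<otimes> D) E \<bullet> (Ldist A B D \<Otimes> \<iota> E) \<bullet> inv_of (prod.Assoc A (B \<oplus> D) E)
    = (inv_of (prod.Assoc A B E) \<Oplus> inv_of (prod.Assoc A D E)) \<bullet> Ldist A (B \<otimes> E) (D \<otimes> E) \<bullet> (\<iota> A \<Otimes> Rdist B D E)"
  using arg_cong[OF Ldist_Rdist_prod_assoc[OF assms], of "\<lambda>h. (inv_of (prod.Assoc A B E) \<Oplus> inv_of (prod.Assoc A D E))
     \<bullet> h \<bullet> inv_of (prod.Assoc A (B \<oplus> D) E)"]
  by simp

lemmas Ldist_push = Ldist_natural Ldist_natural[THEN sum.comp_extend]
  Ldist_natural_left Ldist_natural_left[THEN sum.comp_extend]
  Ldist_inv_assoc Ldist_inv_assoc[THEN sum.comp_extend]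
  Ldist_Rdist_prod_assoc[symmetric] Ldist_Rdist_prod_assoc[symmetric, THEN sum.comp_extend3]

lemmas Rdist_push = Rdist_natural Rdist_natural[THEN sum.comp_extend]
  Rdist_natural_right Rdist_natural_right[THEN sum.comp_extend]
  Rdist_inv_assoc Rdist_inv_assoc[THEN sum.comp_extend3]

definition Sum_hb where
  "Sum_hb A a B b X = inv_of (Ldist X A B) \<bullet> (a X \<Oplus> b X) \<bullet> Rdist A B X"

text \<open>
  Composing with \<open>Ldist\<close> removes the inverse distributor at the end of the sum. What remains are pastings
  of coherence axioms, apart from the compatibility with \<open>\<oplus>\<close>: there the two orders of expanding \<open>(X \<oplus> Y) \<otimes> (A \<oplus> B)\<close>
  differ by the exchange of the middle summands, and so do the two orders of expanding \<open>(A \<oplus> B) \<otimes> (X \<oplus> Y)\<close>.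
  The two exchanges cancel because the exchange is natural and its own inverse.
\<close>

lemma half_braided_sum:
  assumes "half_braided C A a" "half_braided C B b"
  shows "half_braided C (A \<oplus> B) (Sum_hb A a B b)"
proof -
  interpret a: half_braided C A a by fact
  interpret b: half_braided C B b by fact
  let ?s = "Sum_hb A a B b"
  have cancel: "Ldist X A B \<bullet> ?s X = (a X \<Oplus> b X) \<bullet> Rdist A B X" if "X \<in> Obj C" for X
    using that by (simp add: Sum_hb_def)
  have [simp]: "src (?s X) = (A \<oplus> B) \<otimes> X" "tgt (?s X) = X \<otimes> (A \<oplus> B)" "is_iso (?s X)" if "X \<in> Obj C" for X
    using that by (simp_all add: Sum_hb_def)
  show ?thesis
  proof
    fix f Y assume f [simp]: "arr f" and Y: "tgt f = Y"
    have [simp]: "Y \<in> Obj C" using f Y by auto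
    have "Ldist Y A B \<bullet> ?s Y \<bullet> (\<iota> (A \<oplus> B) \<Otimes> f) = Ldist Y A B \<bullet> (f \<Otimes> \<iota> (A \<oplus> B)) \<bullet> ?s (src f)"
      using Y by (simp add: Sum_hb_def Ldist_push Rdist_push sum.tens_tens a.hb_natural b.hb_natural)
    then show "?s Y \<bullet> (\<iota> (A \<oplus> B) \<Otimes> f) = (f \<Otimes> \<iota> (A \<oplus> B)) \<bullet> ?s (src f)"
      by (rule sum.iso_cancel_left) (use Y in simp_all)
  next
    fix X Y assume [simp]: "X \<in> Obj C" "Y \<in> Obj C"
    let ?r = "inv_of (prod.Assoc X Y (A \<oplus> B)) \<bullet> (\<iota> X \<Otimes> ?s Y) \<bullet> prod.Assoc X (A \<oplus> B) Y
      \<bullet> (?s X \<Otimes> \<iota> Y) \<bullet> inv_of (prod.Assoc (A \<oplus> B) X Y)"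
    have "Ldist (X \<otimes> Y) A B \<bullet> ?s (X \<otimes> Y) = Ldist (X \<otimes> Y) A B \<bullet> ?r"
      by (simp add: Sum_hb_def Ldist_push Rdist_push a.hb_prod b.hb_prod sum.comp_tens)
    then show "?s (X \<otimes> Y) = ?r"
      by (rule sum.iso_cancel_left) simp_all
  next
    fix X Y assume [simp]: "X \<in> Obj C" "Y \<in> Obj C"
    show "Rdist X Y (A \<oplus> B) \<bullet> ?s (X \<oplus> Y) = (?s X \<Oplus> ?s Y) \<bullet> Ldist (A \<oplus> B) X Y" (is "?l = ?r")
    proof -
      \<comment> \<open>\<open>?m \<bullet> Rdist X Y (A \<oplus> B)\<close> is the expansion that starts with \<open>Ldist (X \<oplus> Y) A B\<close>\<close>
      let ?m = "sum.Middle (X \<otimes> A) (X \<otimes> B) (Y \<otimes> A) (Y \<otimes> B) \<bullet> (Ldist X A B \<Oplus> Ldist Y A B)"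
      have "?m \<bullet> ?l = (Rdist X Y A \<Oplus> Rdist X Y B) \<bullet> (a (X \<oplus> Y) \<Oplus> b (X \<oplus> Y)) \<bullet> Rdist A B (X \<oplus> Y)"
        by (simp add: Ldist_Rdist_middle[THEN sum.comp_extend3] cancel)
      also have "\<dots> = ((a X \<Oplus> a Y) \<Oplus> (b X \<Oplus> b Y)) \<bullet> (Ldist A X Y \<Oplus> Ldist B X Y) \<bullet> Rdist A B (X \<oplus> Y)"
        by (simp add: sum.tens_tens a.hb_sum b.hb_sum)
      also have "\<dots> = ((a X \<Oplus> a Y) \<Oplus> (b X \<Oplus> b Y)) \<bullet> sum.Middle (A \<otimes> X) (B \<otimes> X) (A \<otimes> Y) (B \<otimes> Y)
          \<bullet> sum.Middle (A \<otimes> X) (A \<otimes> Y) (B \<otimes> X) (B \<otimes> Y) \<bullet> (Ldist A X Y \<Oplus> Ldist B X Y) \<bullet> Rdist A B (X \<oplus> Y)"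
        by (simp add: sum.Middle_Middle[THEN sum.comp_extend])
      also have "\<dots> = ((a X \<Oplus> a Y) \<Oplus> (b X \<Oplus> b Y)) \<bullet> sum.Middle (A \<otimes> X) (B \<otimes> X) (A \<otimes> Y) (B \<otimes> Y)
          \<bullet> (Rdist A B X \<Oplus> Rdist A B Y) \<bullet> Ldist (A \<oplus> B) X Y"
        by (simp add: Ldist_Rdist_middle)
      also have "\<dots> = sum.Middle (X \<otimes> A) (X \<otimes> B) (Y \<otimes> A) (Y \<otimes> B)
          \<bullet> ((a X \<Oplus> b X) \<Oplus> (a Y \<Oplus> b Y)) \<bullet> (Rdist A B X \<Oplus> Rdist A B Y) \<bullet> Ldist (A \<oplus> B) X Y"
        by (simp add: sum.Middle_natural[THEN sum.comp_extend])
      also have "\<dots> = ?m \<bullet> ?r"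
        by (simp add: sum.tens_tens cancel)
      finally show ?thesis by (rule sum.iso_cancel_left) simp_all
    qed
  next
    show "Lnull (A \<oplus> B) \<bullet> ?s \<zero> = Rnull (A \<oplus> B)"
      by (simp add: Sum_hb_def Lnull_sum[symmetric] Rnull_sum[symmetric] a.hb_null b.hb_null
           sum.tens_tens)
  qed simp_all
qed

definition Zero_hb where "Zero_hb X = inv_of (Rnull X) \<bullet> Lnull X"
definition One_hb where "One_hb X = inv_of (prod.Runit X) \<bullet> prod.Lunit X"
definition Prod_hb where
  "Prod_hb A a B b X = prod.Assoc X A B \<bullet> (a X \<Otimes> \<iota> B) \<bullet> inv_of (prod.Assoc A X B) \<bullet> (\<iota> A \<Otimes> b X) \<bullet> prod.Assoc A B X"

lemma half_braided_zero: "half_braided C \<zero> Zero_hb"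
proof
  fix f Y assume f [simp]: "arr f" and Y: "tgt f = Y"
  have [simp]: "Y \<in> Obj C" using f Y by auto
  have "Rnull Y \<bullet> Zero_hb Y \<bullet> (\<iota> \<zero> \<Otimes> f) = Rnull Y \<bullet> (f \<Otimes> \<iota> \<zero>) \<bullet> Zero_hb (src f)"
    using Y by (simp add: Zero_hb_def Lnull_natural Rnull_natural[THEN sum.comp_extend])
  then show "Zero_hb Y \<bullet> (\<iota> \<zero> \<Otimes> f) = (f \<Otimes> \<iota> \<zero>) \<bullet> Zero_hb (src f)"
    by (rule sum.iso_cancel_left) (use Y in \<open>simp_all add: Zero_hb_def\<close>)
next
  fix X Y assume [simp]: "X \<in> Obj C" "Y \<in> Obj C"
  let ?r = "inv_of (prod.Assoc X Y \<zero>) \<bullet> (\<iota> X \<Otimes> Zero_hb Y) \<bullet> prod.Assoc X \<zero> Y \<bullet> (Zero_hb X \<Otimes> \<iota> Y) \<bullet> inv_of (prod.Assoc \<zero> X Y)"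
  have "Rnull (X \<otimes> Y) \<bullet> ?r = Rnull X \<bullet> (\<iota> X \<Otimes> Lnull Y) \<bullet> prod.Assoc X \<zero> Y \<bullet> (Zero_hb X \<Otimes> \<iota> Y) \<bullet> inv_of (prod.Assoc \<zero> X Y)"
    by (simp add: Zero_hb_def flip: Rnull_prod)
  also have "\<dots> = Lnull Y \<bullet> (Lnull X \<Otimes> \<iota> Y) \<bullet> inv_of (prod.Assoc \<zero> X Y)"
    by (simp add: Zero_hb_def null_middle[THEN sum.comp_extend3])
  also have "\<dots> = Lnull (X \<otimes> Y)"
    by (simp add: Lnull_prod[symmetric, THEN sum.comp_extend])
  also have "\<dots> = Rnull (X \<otimes> Y) \<bullet> Zero_hb (X \<otimes> Y)" by (simp add: Zero_hb_def)
  finally show "Zero_hb (X \<otimes> Y) = ?r"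
    by (rule sum.iso_cancel_left[OF sym]) (simp_all add: Zero_hb_def)
next
  fix X Y assume [simp]: "X \<in> Obj C" "Y \<in> Obj C"
  have "sum.Lunit \<zero> \<bullet> (Rnull X \<Oplus> Rnull Y) \<bullet> Rdist X Y \<zero> \<bullet> Zero_hb (X \<oplus> Y)
     = sum.Lunit \<zero> \<bullet> (Rnull X \<Oplus> Rnull Y) \<bullet> (Zero_hb X \<Oplus> Zero_hb Y) \<bullet> Ldist \<zero> X Y"
    by (simp add: Rnull_sum[THEN sum.comp_extend3] Zero_hb_def sum.tens_tens Lnull_sum)
  then have "(Rnull X \<Oplus> Rnull Y) \<bullet> Rdist X Y \<zero> \<bullet> Zero_hb (X \<oplus> Y)
     = (Rnull X \<Oplus> Rnull Y) \<bullet> (Zero_hb X \<Oplus> Zero_hb Y) \<bullet> Ldist \<zero> X Y"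
    by (rule sum.iso_cancel_left) (simp_all add: Zero_hb_def)
  then show "Rdist X Y \<zero> \<bullet> Zero_hb (X \<oplus> Y) = (Zero_hb X \<Oplus> Zero_hb Y) \<bullet> Ldist \<zero> X Y"
    by (rule sum.iso_cancel_left) (simp_all add: Zero_hb_def)
qed (simp_all add: Zero_hb_def Lnull_Rnull_zero)

lemma half_braided_one: "half_braided C \<one> One_hb"
proof
  fix f Y assume f [simp]: "arr f" and Y: "tgt f = Y"
  have [simp]: "Y \<in> Obj C" using f Y by auto
  have "prod.Runit Y \<bullet> One_hb Y \<bullet> (\<iota> \<one> \<Otimes> f) = prod.Runit Y \<bullet> (f \<Otimes> \<iota> \<one>) \<bullet> One_hb (src f)"
    using Y by (simp add: One_hb_def prod.Lunit_natural prod.Runit_natural[THEN sum.comp_extend])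
  then show "One_hb Y \<bullet> (\<iota> \<one> \<Otimes> f) = (f \<Otimes> \<iota> \<one>) \<bullet> One_hb (src f)"
    by (rule sum.iso_cancel_left) (use Y in \<open>simp_all add: One_hb_def\<close>)
next
  fix X Y assume [simp]: "X \<in> Obj C" "Y \<in> Obj C"
  let ?r = "inv_of (prod.Assoc X Y \<one>) \<bullet> (\<iota> X \<Otimes> One_hb Y) \<bullet> prod.Assoc X \<one> Y \<bullet> (One_hb X \<Otimes> \<iota> Y) \<bullet> inv_of (prod.Assoc \<one> X Y)"
  have "prod.Runit (X \<otimes> Y) \<bullet> ?r = (\<iota> X \<Otimes> prod.Lunit Y) \<bullet> prod.Assoc X \<one> Y \<bullet> (One_hb X \<Otimes> \<iota> Y) \<bullet> inv_of (prod.Assoc \<one> X Y)"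
    by (simp add: One_hb_def flip: prod.Runit_tens)
  also have "\<dots> = (prod.Lunit X \<Otimes> \<iota> Y) \<bullet> inv_of (prod.Assoc \<one> X Y)"
    by (simp add: One_hb_def prod.Triangle[THEN sum.comp_extend])
  also have "\<dots> = prod.Lunit (X \<otimes> Y)"
    by (simp flip: prod.Lunit_tens)
  also have "\<dots> = prod.Runit (X \<otimes> Y) \<bullet> One_hb (X \<otimes> Y)" by (simp add: One_hb_def)
  finally show "One_hb (X \<otimes> Y) = ?r"
    by (rule sum.iso_cancel_left[OF sym]) (simp_all add: One_hb_def)
next
  fix X Y assume [simp]: "X \<in> Obj C" "Y \<in> Obj C"
  have "(prod.Runit X \<Oplus> prod.Runit Y) \<bullet> Rdist X Y \<one> \<bullet> One_hb (X \<oplus> Y)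
     = (prod.Runit X \<Oplus> prod.Runit Y) \<bullet> (One_hb X \<Oplus> One_hb Y) \<bullet> Ldist \<one> X Y"
    by (simp add: Runit_sum[THEN sum.comp_extend] One_hb_def sum.tens_tens Lunit_sum)
  then show "Rdist X Y \<one> \<bullet> One_hb (X \<oplus> Y) = (One_hb X \<Oplus> One_hb Y) \<bullet> Ldist \<one> X Y"
    by (rule sum.iso_cancel_left) (simp_all add: One_hb_def)
qed (simp_all add: One_hb_def Lunit_zero flip: Runit_zero)

lemma half_braided_prod:
  assumes "half_braided C A a" "half_braided C B b"
  shows "half_braided C (A \<otimes> B) (Prod_hb A a B b)"
proof -
  interpret a: half_braided C A a by fact
  interpret b: half_braided C B b by fact
  let ?p = "Prod_hb A a B b"
  have [simp]: "src (?p X) = (A \<otimes> B) \<otimes> X" "tgt (?p X) = X \<otimes> (A \<otimes> B)" "is_iso (?p X)" if "X \<in> Obj C" for X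
    using that by (simp_all add: Prod_hb_def)
  note push = prod.Assoc_natural prod.Assoc_natural[THEN sum.comp_extend]
    prod.Assoc_natural_right prod.Assoc_natural_right[THEN sum.comp_extend]
    prod.inv_Assoc_natural prod.inv_Assoc_natural[THEN sum.comp_extend]
  show ?thesis
  proof
    fix f Y assume f [simp]: "arr f" and Y [simp]: "tgt f = Y"
    have [simp]: "Y \<in> Obj C" using sum.arr_obj(2)[OF f] by simp
    note nat = a.hb_natural[THEN prod.whisker_eq_right, THEN sum.comp_extend, of f Y]
      b.hb_natural[THEN prod.whisker_eq_left, THEN sum.comp_extend, of f Y]
    show "?p Y \<bullet> (\<iota> (A \<otimes> B) \<Otimes> f) = (f \<Otimes> \<iota> (A \<otimes> B)) \<bullet> ?p (src f)"
      unfolding Prod_hb_def by (simp add: push nat)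
  next
    fix X Y assume [simp]: "X \<in> Obj C" "Y \<in> Obj C"
    \<comment> \<open>on one side \<open>X\<close> and \<open>Y\<close> both pass \<open>B\<close> before either passes \<open>A\<close>, on the other \<open>X\<close> passes \<open>B\<close> and \<open>A\<close>
      before \<open>Y\<close> moves: \<open>mid\<close> rebrackets the first step, \<open>X\<close> passing \<open>B\<close>, and \<open>swap\<close> exchanges the
      two middle steps\<close>
    have mid: "inv_of (prod.Assoc A X (B \<otimes> Y)) \<bullet> (\<iota> A \<Otimes> prod.Assoc X B Y) \<bullet> (\<iota> A \<Otimes> b X \<Otimes> \<iota> Y)
        \<bullet> (\<iota> A \<Otimes> inv_of (prod.Assoc B X Y)) \<bullet> prod.Assoc A B (X \<otimes> Y)
      = prod.Assoc (A \<otimes> X) B Y \<bullet> (inv_of (prod.Assoc A X B) \<Otimes> \<iota> Y) \<bullet> ((\<iota> A \<Otimes> b X) \<Otimes> \<iota> Y)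
        \<bullet> (prod.Assoc A B X \<Otimes> \<iota> Y) \<bullet> inv_of (prod.Assoc (A \<otimes> B) X Y)" (is "?midl = ?midr")
      by (simp add: prod.Pentagon3[THEN sum.comp_extend] prod.Pentagon4 push)
    have swap: "(a X \<Otimes> \<iota> (Y \<otimes> B)) \<bullet> (\<iota> (A \<otimes> X) \<Otimes> b Y) = (\<iota> (X \<otimes> A) \<Otimes> b Y) \<bullet> (a X \<Otimes> \<iota> (B \<otimes> Y))"
      using prod.whisker_swap[of "a X" "b Y"] by simp
    let ?q = "inv_of (prod.Assoc X Y (A \<otimes> B)) \<bullet> (\<iota> X \<Otimes> prod.Assoc Y A B) \<bullet> (\<iota> X \<Otimes> a Y \<Otimes> \<iota> B)
      \<bullet> (\<iota> X \<Otimes> inv_of (prod.Assoc A Y B))"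
    have "?p (X \<otimes> Y) = ?q \<bullet> prod.Assoc X A (Y \<otimes> B) \<bullet> (a X \<Otimes> \<iota> (Y \<otimes> B))
      \<bullet> (\<iota> (A \<otimes> X) \<Otimes> b Y) \<bullet> ?midl"
      unfolding Prod_hb_def
      by (simp add: a.hb_prod b.hb_prod push prod.Pentagon1[THEN sum.comp_extend] prod.Pentagon2[THEN sum.comp_extend])
    also have "\<dots> = ?q \<bullet> (\<iota> X \<Otimes> \<iota> A \<Otimes> b Y) \<bullet> prod.Assoc X A (B \<otimes> Y) \<bullet> (a X \<Otimes> \<iota> (B \<otimes> Y)) \<bullet> ?midl"
      by (simp add: swap[THEN sum.comp_extend] push)
    also have "\<dots> = inv_of (prod.Assoc X Y (A \<otimes> B)) \<bullet> (\<iota> X \<Otimes> ?p Y) \<bullet> prod.Assoc X (A \<otimes> B) Y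
      \<bullet> (?p X \<Otimes> \<iota> Y) \<bullet> inv_of (prod.Assoc (A \<otimes> B) X Y)"
      unfolding mid Prod_hb_def by (simp add: push prod.Pentagon[THEN sum.comp_extend3])
    finally show "?p (X \<otimes> Y) = inv_of (prod.Assoc X Y (A \<otimes> B)) \<bullet> (\<iota> X \<Otimes> ?p Y) \<bullet> prod.Assoc X (A \<otimes> B) Y
      \<bullet> (?p X \<Otimes> \<iota> Y) \<bullet> inv_of (prod.Assoc (A \<otimes> B) X Y)" .
  next
    fix X Y assume [simp]: "X \<in> Obj C" "Y \<in> Obj C"
    note sum = a.hb_sum[THEN prod.whisker_eq_right, THEN sum.comp_extend] b.hb_sum[THEN prod.whisker_eq_left, THEN sum.comp_extend]
    show "Rdist X Y (A \<otimes> B) \<bullet> ?p (X \<oplus> Y) = (?p X \<Oplus> ?p Y) \<bullet> Ldist (A \<otimes> B) X Y"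
      unfolding Prod_hb_def
      by (simp add: Rdist_prod_assoc[symmetric, THEN sum.comp_extend] sum Rdist_push Ldist_push
        Ldist_prod_assoc sum.comp_tens Rdist_Ldist_inv_assoc[THEN sum.comp_extend3])
  next
    have "Lnull (A \<otimes> B) \<bullet> ?p \<zero> = Lnull B \<bullet> (Lnull A \<Otimes> \<iota> B) \<bullet> (a \<zero> \<Otimes> \<iota> B) \<bullet> inv_of (prod.Assoc A \<zero> B) \<bullet> (\<iota> A \<Otimes> b \<zero>) \<bullet> prod.Assoc A B \<zero>"
      by (simp add: Prod_hb_def Lnull_prod[THEN sum.comp_extend])
    also have "\<dots> = Lnull B \<bullet> (Rnull A \<Otimes> \<iota> B) \<bullet> inv_of (prod.Assoc A \<zero> B) \<bullet> (\<iota> A \<Otimes> b \<zero>) \<bullet> prod.Assoc A B \<zero>"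
      by (simp add: a.hb_null[THEN prod.whisker_eq_right, THEN sum.comp_extend])
    also have "\<dots> = Rnull A \<bullet> (\<iota> A \<Otimes> Lnull B) \<bullet> (\<iota> A \<Otimes> b \<zero>) \<bullet> prod.Assoc A B \<zero>"
      by (simp add: null_middle[symmetric, THEN sum.comp_extend])
    also have "\<dots> = Rnull (A \<otimes> B)"
      by (simp add: b.hb_null[THEN prod.whisker_eq_left, THEN sum.comp_extend] Rnull_prod)
    finally show "Lnull (A \<otimes> B) \<bullet> ?p \<zero> = Rnull (A \<otimes> B)" .
  qed simp_all
qed

end

section \<open>Arrows that commute with half braidings\<close>

context tight_bimonoidal_category
begin

definition center_mor where
  "center_mor a b f \<longleftrightarrow> arr f \<and> (\<forall>X\<in>Obj C. (\<iota> X \<Otimes> f) \<bullet> a X = b X \<bullet> (f \<Otimes> \<iota> X))"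

lemma center_morI:
  "\<lbrakk>arr f; \<And>X. X \<in> Obj C \<Longrightarrow> (\<iota> X \<Otimes> f) \<bullet> a X = b X \<bullet> (f \<Otimes> \<iota> X)\<rbrakk> \<Longrightarrow> center_mor a b f"
  by (simp add: center_mor_def)

lemma center_mor_arr: "center_mor a b f \<Longrightarrow> arr f"
  by (simp add: center_mor_def)

lemma center_mor_eq: "\<lbrakk>center_mor a b f; X \<in> Obj C\<rbrakk> \<Longrightarrow> (\<iota> X \<Otimes> f) \<bullet> a X = b X \<bullet> (f \<Otimes> \<iota> X)"
  by (simp add: center_mor_def)

lemma Sum_hb_cancel:
  assumes "half_braided C A a" "half_braided C B b" "X \<in> Obj C"
  shows "Ldist X A B \<bullet> Sum_hb A a B b X = (a X \<Oplus> b X) \<bullet> Rdist A B X"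
proof -
  interpret a: half_braided C A a by fact
  interpret b: half_braided C B b by fact
  show ?thesis using assms(3) by (simp add: Sum_hb_def)
qed

lemma hb_simps:
  assumes "half_braided C A a"
  shows "A \<in> Obj C" and "X \<in> Obj C \<Longrightarrow> src (a X) = A \<otimes> X" and "X \<in> Obj C \<Longrightarrow> tgt (a X) = X \<otimes> A"
    and "X \<in> Obj C \<Longrightarrow> is_iso (a X)"
proof -
  interpret a: half_braided C A a by fact
  show "A \<in> Obj C" "X \<in> Obj C \<Longrightarrow> src (a X) = A \<otimes> X" "X \<in> Obj C \<Longrightarrow> tgt (a X) = X \<otimes> A"
    "X \<in> Obj C \<Longrightarrow> is_iso (a X)" by simp_all
qed

lemma Zero_hb_simps [simp]:
  assumes "X \<in> Obj C"
  shows "src (Zero_hb X) = \<zero> \<otimes> X" "tgt (Zero_hb X) = X \<otimes> \<zero>" "is_iso (Zero_hb X)"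
  using assms by (simp_all add: Zero_hb_def)

lemma One_hb_simps [simp]:
  assumes "X \<in> Obj C"
  shows "src (One_hb X) = \<one> \<otimes> X" "tgt (One_hb X) = X \<otimes> \<one>" "is_iso (One_hb X)"
  using assms by (simp_all add: One_hb_def)

lemma center_mor_id: "half_braided C A a \<Longrightarrow> center_mor a a (\<iota> A)"
  by (rule center_morI) (simp_all add: hb_simps)

lemma center_mor_comp:
  assumes "half_braided C A a" "half_braided C B b" "half_braided C D d"
    and "center_mor a b f" "center_mor b d g" "src f = A" "tgt f = B" "src g = B" "tgt g = D"
  shows "center_mor a d (g \<bullet> f)"
proof (rule center_morI)
  note [simp] = hb_simps[OF assms(1)] hb_simps[OF assms(2)] hb_simps[OF assms(3)]
    assms(4,5)[THEN center_mor_arr] assms(6-)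
  show "arr (g \<bullet> f)" by simp
  fix X assume [simp]: "X \<in> Obj C"
  show "(\<iota> X \<Otimes> (g \<bullet> f)) \<bullet> a X = d X \<bullet> ((g \<bullet> f) \<Otimes> \<iota> X)"
    by (simp add: center_mor_eq[OF assms(4)] center_mor_eq[OF assms(5), THEN sum.comp_extend])
qed

lemma center_mor_inv:
  assumes "half_braided C A a" "half_braided C B b"
    and "center_mor a b f" "is_iso f" "src f = A" "tgt f = B"
  shows "center_mor b a (inv_of f)"
proof (rule center_morI)
  note [simp] = hb_simps[OF assms(1)] hb_simps[OF assms(2)] assms(4-)
  show "arr (inv_of f)" by simp
  fix X assume [simp]: "X \<in> Obj C"
  show "(\<iota> X \<Otimes> inv_of f) \<bullet> b X = a X \<bullet> (inv_of f \<Otimes> \<iota> X)"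
    using center_mor_eq[OF assms(3), THEN sum.square_inv_vertical, of X] by simp
qed

context
  fixes A a
  assumes A: "half_braided C A a"
begin

interpretation a: half_braided C A a by (fact A)

lemma center_mor_sum_Lunit: "center_mor (Sum_hb \<zero> Zero_hb A a) a (sum.Lunit A)"
proof (rule center_morI)
  fix X assume [simp]: "X \<in> Obj C"
  have "(\<iota> X \<Otimes> sum.Lunit A) \<bullet> Sum_hb \<zero> Zero_hb A a X = sum.Lunit (X \<otimes> A) \<bullet> (\<iota> \<zero> \<Oplus> a X) \<bullet> (Lnull X \<Oplus> \<iota> (A \<otimes> X)) \<bullet> Rdist \<zero> A X"
    by (simp add: Sum_hb_def Ldist_zero_left[symmetric] sum.tens_tens Zero_hb_def)
  also have "\<dots> = a X \<bullet> (sum.Lunit A \<Otimes> \<iota> X)"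
    by (simp add: sum.Lunit_natural[THEN sum.comp_extend] Rdist_zero_left)
  finally show "(\<iota> X \<Otimes> sum.Lunit A) \<bullet> Sum_hb \<zero> Zero_hb A a X = a X \<bullet> (sum.Lunit A \<Otimes> \<iota> X)" .
qed simp

lemma center_mor_sum_Runit: "center_mor (Sum_hb A a \<zero> Zero_hb) a (sum.Runit A)"
proof (rule center_morI)
  fix X assume [simp]: "X \<in> Obj C"
  have "(\<iota> X \<Otimes> sum.Runit A) \<bullet> Sum_hb A a \<zero> Zero_hb X = sum.Runit (X \<otimes> A) \<bullet> (a X \<Oplus> \<iota> \<zero>) \<bullet> (\<iota> (A \<otimes> X) \<Oplus> Lnull X) \<bullet> Rdist A \<zero> X"
    by (simp add: Sum_hb_def Ldist_zero_right[symmetric] sum.tens_tens Zero_hb_def)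
  also have "\<dots> = a X \<bullet> (sum.Runit A \<Otimes> \<iota> X)"
    by (simp add: sum.Runit_natural[THEN sum.comp_extend] Rdist_zero_right)
  finally show "(\<iota> X \<Otimes> sum.Runit A) \<bullet> Sum_hb A a \<zero> Zero_hb X = a X \<bullet> (sum.Runit A \<Otimes> \<iota> X)" .
qed simp

lemma center_mor_prod_Lunit: "center_mor (Prod_hb \<one> One_hb A a) a (prod.Lunit A)"
proof (rule center_morI)
  fix X assume [simp]: "X \<in> Obj C"
  have "(\<iota> X \<Otimes> prod.Lunit A) \<bullet> Prod_hb \<one> One_hb A a X
     = (prod.Lunit X \<Otimes> \<iota> A) \<bullet> inv_of (prod.Assoc \<one> X A) \<bullet> (\<iota> \<one> \<Otimes> a X) \<bullet> prod.Assoc \<one> A X"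
    by (simp add: Prod_hb_def prod.Triangle[THEN sum.comp_extend] One_hb_def)
  also have "\<dots> = a X \<bullet> (prod.Lunit A \<Otimes> \<iota> X)"
    by (simp add: prod.Lunit_natural[THEN sum.comp_extend] flip: prod.Lunit_tens)
  finally show "(\<iota> X \<Otimes> prod.Lunit A) \<bullet> Prod_hb \<one> One_hb A a X = a X \<bullet> (prod.Lunit A \<Otimes> \<iota> X)" .
qed simp

lemma center_mor_prod_Runit: "center_mor (Prod_hb A a \<one> One_hb) a (prod.Runit A)"
proof (rule center_morI)
  fix X assume [simp]: "X \<in> Obj C"
  have "(\<iota> X \<Otimes> prod.Runit A) \<bullet> Prod_hb A a \<one> One_hb X
     = a X \<bullet> prod.Runit (A \<otimes> X) \<bullet> inv_of (prod.Assoc A X \<one>) \<bullet> (\<iota> A \<Otimes> One_hb X) \<bullet> prod.Assoc A \<one> X"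
    by (simp add: Prod_hb_def prod.Runit_tens[THEN sum.comp_extend] prod.Runit_natural[THEN sum.comp_extend])
  also have "\<dots> = a X \<bullet> (prod.Runit A \<Otimes> \<iota> X)"
    by (simp add: One_hb_def prod.Triangle flip: prod.Runit_tens)
  finally show "(\<iota> X \<Otimes> prod.Runit A) \<bullet> Prod_hb A a \<one> One_hb X = a X \<bullet> (prod.Runit A \<Otimes> \<iota> X)" .
qed simp

lemma center_mor_Lnull: "center_mor (Prod_hb \<zero> Zero_hb A a) Zero_hb (Lnull A)"
proof (rule center_morI)
  fix X assume [simp]: "X \<in> Obj C"
  have "Rnull X \<bullet> (\<iota> X \<Otimes> Lnull A) \<bullet> Prod_hb \<zero> Zero_hb A a X
     = Lnull A \<bullet> (Lnull X \<Otimes> \<iota> A) \<bullet> inv_of (prod.Assoc \<zero> X A) \<bullet> (\<iota> \<zero> \<Otimes> a X) \<bullet> prod.Assoc \<zero> A X"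
    by (simp add: Prod_hb_def null_middle[THEN sum.comp_extend3] Zero_hb_def)
  also have "\<dots> = Lnull (A \<otimes> X) \<bullet> prod.Assoc \<zero> A X"
    by (simp add: Lnull_prod[symmetric, THEN sum.comp_extend] Lnull_natural[THEN sum.comp_extend])
  also have "\<dots> = Rnull X \<bullet> Zero_hb X \<bullet> (Lnull A \<Otimes> \<iota> X)"
    by (simp add: Lnull_prod Zero_hb_def)
  finally show "(\<iota> X \<Otimes> Lnull A) \<bullet> Prod_hb \<zero> Zero_hb A a X = Zero_hb X \<bullet> (Lnull A \<Otimes> \<iota> X)"
    by (rule sum.iso_cancel_left) (simp_all add: Prod_hb_def)
qed simp

lemma center_mor_Rnull: "center_mor (Prod_hb A a \<zero> Zero_hb) Zero_hb (Rnull A)"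
proof (rule center_morI)
  fix X assume [simp]: "X \<in> Obj C"
  have "Rnull X \<bullet> (\<iota> X \<Otimes> Rnull A) \<bullet> Prod_hb A a \<zero> Zero_hb X
     = Rnull (A \<otimes> X) \<bullet> inv_of (prod.Assoc A X \<zero>) \<bullet> (\<iota> A \<Otimes> Zero_hb X) \<bullet> prod.Assoc A \<zero> X"
    by (simp add: Prod_hb_def Rnull_prod[THEN sum.comp_extend3] Rnull_natural[THEN sum.comp_extend])
  also have "\<dots> = Rnull X \<bullet> Zero_hb X \<bullet> (Rnull A \<Otimes> \<iota> X)"
    by (simp add: Zero_hb_def null_middle flip: Rnull_prod)
  finally show "(\<iota> X \<Otimes> Rnull A) \<bullet> Prod_hb A a \<zero> Zero_hb X = Zero_hb X \<bullet> (Rnull A \<Otimes> \<iota> X)"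
    by (rule sum.iso_cancel_left) (simp_all add: Prod_hb_def)
qed simp

end

context
  fixes A a B b
  assumes A: "half_braided C A a" and B: "half_braided C B b"
begin

interpretation a: half_braided C A a by (fact A)
interpretation b: half_braided C B b by (fact B)

lemma Sum_hb_simps [simp]:
  assumes "X \<in> Obj C"
  shows "src (Sum_hb A a B b X) = (A \<oplus> B) \<otimes> X" "tgt (Sum_hb A a B b X) = X \<otimes> (A \<oplus> B)" "is_iso (Sum_hb A a B b X)"
  using assms by (simp_all add: Sum_hb_def)

lemma Prod_hb_simps [simp]:
  assumes "X \<in> Obj C"
  shows "src (Prod_hb A a B b X) = (A \<otimes> B) \<otimes> X" "tgt (Prod_hb A a B b X) = X \<otimes> (A \<otimes> B)" "is_iso (Prod_hb A a B b X)"
  using assms by (simp_all add: Prod_hb_def)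

lemma center_mor_sum:
  assumes A': "half_braided C A' a'" and B': "half_braided C B' b'"
    and f: "center_mor a a' f" "src f = A" "tgt f = A'" and g: "center_mor b b' g" "src g = B" "tgt g = B'"
  shows "center_mor (Sum_hb A a B b) (Sum_hb A' a' B' b') (f \<Oplus> g)"
proof (rule center_morI)
  interpret a': half_braided C A' a' by fact
  interpret b': half_braided C B' b' by fact
  note [simp] = f(2,3) g(2,3) f(1)[THEN center_mor_arr] g(1)[THEN center_mor_arr]
  show "arr (f \<Oplus> g)" by simp
  fix X assume [simp]: "X \<in> Obj C"
  have "Ldist X A' B' \<bullet> (\<iota> X \<Otimes> (f \<Oplus> g)) \<bullet> Sum_hb A a B b X
    = Ldist X A' B' \<bullet> Sum_hb A' a' B' b' X \<bullet> ((f \<Oplus> g) \<Otimes> \<iota> X)"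
    by (simp add: Sum_hb_def Ldist_push Rdist_push sum.tens_tens center_mor_eq[OF f(1)] center_mor_eq[OF g(1)])
  then show "(\<iota> X \<Otimes> (f \<Oplus> g)) \<bullet> Sum_hb A a B b X = Sum_hb A' a' B' b' X \<bullet> ((f \<Oplus> g) \<Otimes> \<iota> X)"
    by (rule sum.iso_cancel_left) (simp_all add: Sum_hb_def)
qed

lemma center_mor_sum_braid: "center_mor (Sum_hb A a B b) (Sum_hb B b A a) (sum.Braid A B)"
proof (rule center_morI)
  fix X assume [simp]: "X \<in> Obj C"
  have "Ldist X B A \<bullet> (\<iota> X \<Otimes> sum.Braid A B) \<bullet> Sum_hb A a B b X = Ldist X B A \<bullet> Sum_hb B b A a X \<bullet> (sum.Braid A B \<Otimes> \<iota> X)"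
    by (simp add: Sum_hb_def Ldist_sym[THEN sum.comp_extend] Rdist_sym sum.Braid_natural[THEN sum.comp_extend])
  then show "(\<iota> X \<Otimes> sum.Braid A B) \<bullet> Sum_hb A a B b X = Sum_hb B b A a X \<bullet> (sum.Braid A B \<Otimes> \<iota> X)"
    by (rule sum.iso_cancel_left) (simp_all add: Sum_hb_def)
qed simp

lemma center_mor_prod:
  assumes A': "half_braided C A' a'" and B': "half_braided C B' b'"
    and f: "center_mor a a' f" "src f = A" "tgt f = A'" and g: "center_mor b b' g" "src g = B" "tgt g = B'"
  shows "center_mor (Prod_hb A a B b) (Prod_hb A' a' B' b') (f \<Otimes> g)"
proof (rule center_morI)
  interpret a': half_braided C A' a' by fact
  interpret b': half_braided C B' b' by fact
  note [simp] = f(2,3) g(2,3) f(1)[THEN center_mor_arr] g(1)[THEN center_mor_arr]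
  show "arr (f \<Otimes> g)" by simp
  fix X assume [simp]: "X \<in> Obj C"
  have slide: "(\<iota> X \<Otimes> f \<Otimes> g) \<bullet> prod.Assoc X A B = prod.Assoc X A' B' \<bullet> ((\<iota> X \<Otimes> f) \<Otimes> g)"
    "((f \<Otimes> \<iota> X) \<Otimes> g) \<bullet> inv_of (prod.Assoc A X B) = inv_of (prod.Assoc A' X B') \<bullet> (f \<Otimes> \<iota> X \<Otimes> g)"
    by (simp_all add: prod.Assoc_natural prod.inv_Assoc_natural)
  have "(\<iota> X \<Otimes> f \<Otimes> g) \<bullet> Prod_hb A a B b X = prod.Assoc X A' B' \<bullet> (((\<iota> X \<Otimes> f) \<bullet> a X) \<Otimes> g)
      \<bullet> inv_of (prod.Assoc A X B) \<bullet> (\<iota> A \<Otimes> b X) \<bullet> prod.Assoc A B X"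
    by (simp add: Prod_hb_def slide(1)[THEN sum.comp_extend] prod.tens_tens del: prod.whisker_left prod.whisker_right)
  also have "\<dots> = prod.Assoc X A' B' \<bullet> (a' X \<Otimes> \<iota> B') \<bullet> ((f \<Otimes> \<iota> X) \<Otimes> g)
      \<bullet> inv_of (prod.Assoc A X B) \<bullet> (\<iota> A \<Otimes> b X) \<bullet> prod.Assoc A B X"
    by (simp add: center_mor_eq[OF f(1)] prod.tens_tens del: prod.whisker_left prod.whisker_right)
  also have "\<dots> = prod.Assoc X A' B' \<bullet> (a' X \<Otimes> \<iota> B') \<bullet> inv_of (prod.Assoc A' X B') \<bullet> (f \<Otimes> ((\<iota> X \<Otimes> g) \<bullet> b X)) \<bullet> prod.Assoc A B X"
    by (simp add: slide(2)[THEN sum.comp_extend] prod.tens_tens del: prod.whisker_left prod.whisker_right)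
  also have "\<dots> = prod.Assoc X A' B' \<bullet> (a' X \<Otimes> \<iota> B') \<bullet> inv_of (prod.Assoc A' X B') \<bullet> (\<iota> A' \<Otimes> b' X) \<bullet> (f \<Otimes> (g \<Otimes> \<iota> X)) \<bullet> prod.Assoc A B X"
    by (simp add: center_mor_eq[OF g(1)] prod.tens_tens del: prod.whisker_left prod.whisker_right)
  also have "\<dots> = Prod_hb A' a' B' b' X \<bullet> ((f \<Otimes> g) \<Otimes> \<iota> X)"
    by (simp add: prod.Assoc_natural Prod_hb_def)
  finally show "(\<iota> X \<Otimes> f \<Otimes> g) \<bullet> Prod_hb A a B b X = Prod_hb A' a' B' b' X \<bullet> ((f \<Otimes> g) \<Otimes> \<iota> X)" .
qed

text \<open>
  This is the Yang-Baxter relation. As \<open>a\<close> is compatible with \<open>\<otimes>\<close>, one side is, up to associators,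
  \<open>a (X \<otimes> B) \<bullet> (\<iota> A \<Otimes> b X)\<close> and the other \<open>(b X \<Otimes> \<iota> A) \<bullet> a (B \<otimes> X)\<close>; these agree by naturality of
  \<open>a\<close> in the arrow \<open>b X\<close>.
\<close>

lemma center_mor_braiding: "center_mor (Prod_hb A a B b) (Prod_hb B b A a) (a B)"
proof (rule center_morI)
  fix X assume [simp]: "X \<in> Obj C"
  have "(\<iota> X \<Otimes> a B) \<bullet> Prod_hb A a B b X = prod.Assoc X B A \<bullet> (a (X \<otimes> B) \<bullet> (\<iota> A \<Otimes> b X)) \<bullet> prod.Assoc A B X"
    by (simp add: Prod_hb_def a.hb_prod)
  also have "\<dots> = prod.Assoc X B A \<bullet> ((b X \<Otimes> \<iota> A) \<bullet> a (B \<otimes> X)) \<bullet> prod.Assoc A B X"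
    by (simp only: a.hb_natural[of "b X" "X \<otimes> B"] b.hb_tgt b.hb_src b.hb_iso sum.is_iso_arr \<open>X \<in> Obj C\<close>)
  also have "\<dots> = Prod_hb B b A a X \<bullet> (a B \<Otimes> \<iota> X)"
    by (simp add: Prod_hb_def a.hb_prod)
  finally show "(\<iota> X \<Otimes> a B) \<bullet> Prod_hb A a B b X = Prod_hb B b A a X \<bullet> (a B \<Otimes> \<iota> X)" .
qed simp

context
  fixes D d
  assumes D: "half_braided C D d"
begin

interpretation d: half_braided C D d by (fact D)

text \<open>
  Composed with the full expansion \<open>?t\<close> of \<open>X \<otimes> (A \<oplus> (B \<oplus> D))\<close>, both sides become
  \<open>a X \<Oplus> (b X \<Oplus> d X)\<close> preceded by an expansion of \<open>((A \<oplus> B) \<oplus> D) \<otimes> X\<close>, and these expansions agree by the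
  axiom for \<open>\<delta>\<^sup>r\<close> and \<open>\<alpha>\<^sup>\<oplus>\<close>.
\<close>

lemma center_mor_sum_Assoc:
  "center_mor (Sum_hb (A \<oplus> B) (Sum_hb A a B b) D d) (Sum_hb A a (B \<oplus> D) (Sum_hb B b D d)) (sum.Assoc A B D)"
    (is "center_mor ?l ?r _")
proof (rule center_morI)
  fix X assume [simp]: "X \<in> Obj C"
  let ?t = "(\<iota> (X \<otimes> A) \<Oplus> Ldist X B D) \<bullet> Ldist X A (B \<oplus> D)"
  have [simp]: "src (?l X) = ((A \<oplus> B) \<oplus> D) \<otimes> X" "tgt (?l X) = X \<otimes> ((A \<oplus> B) \<oplus> D)" "is_iso (?l X)"
    "src (?r X) = (A \<oplus> B \<oplus> D) \<otimes> X" "tgt (?r X) = X \<otimes> (A \<oplus> B \<oplus> D)" "is_iso (?r X)"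
    using half_braided_sum[OF half_braided_sum[OF A B] D] half_braided_sum[OF A half_braided_sum[OF B D]] by (simp_all add: hb_simps)
  note [simp] = hb_simps[OF half_braided_sum[OF B D]]
  note cancel = half_braided_sum[OF A B, THEN Sum_hb_cancel, OF D] Sum_hb_cancel[OF A half_braided_sum[OF B D]]
    Sum_hb_cancel[OF A B] Sum_hb_cancel[OF B D]
  have "?t \<bullet> (\<iota> X \<Otimes> sum.Assoc A B D) \<bullet> ?l X
     = sum.Assoc (X \<otimes> A) (X \<otimes> B) (X \<otimes> D) \<bullet> (Ldist X A B \<Oplus> \<iota> (X \<otimes> D)) \<bullet> (Sum_hb A a B b X \<Oplus> d X) \<bullet> Rdist (A \<oplus> B) D X"
    by (simp add: Ldist_sum_assoc[symmetric, THEN sum.comp_extend3] cancel)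
  also have "\<dots> = sum.Assoc (X \<otimes> A) (X \<otimes> B) (X \<otimes> D) \<bullet> ((a X \<Oplus> b X) \<Oplus> d X) \<bullet> (Rdist A B X \<Oplus> \<iota> (D \<otimes> X)) \<bullet> Rdist (A \<oplus> B) D X"
    by (simp add: sum.tens_tens cancel)
  also have "\<dots> = (a X \<Oplus> (b X \<Oplus> d X)) \<bullet> (\<iota> (A \<otimes> X) \<Oplus> Rdist B D X) \<bullet> Rdist A (B \<oplus> D) X \<bullet> (sum.Assoc A B D \<Otimes> \<iota> X)"
    by (simp add: sum.Assoc_natural[THEN sum.comp_extend] flip: Rdist_sum_assoc)
  also have "\<dots> = (\<iota> (X \<otimes> A) \<Oplus> Ldist X B D) \<bullet> (a X \<Oplus> Sum_hb B b D d X) \<bullet> Rdist A (B \<oplus> D) X \<bullet> (sum.Assoc A B D \<Otimes> \<iota> X)"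
    by (simp add: sum.tens_tens cancel)
  also have "\<dots> = ?t \<bullet> ?r X \<bullet> (sum.Assoc A B D \<Otimes> \<iota> X)"
    by (simp add: cancel[THEN sum.comp_extend])
  finally show "(\<iota> X \<Otimes> sum.Assoc A B D) \<bullet> ?l X = ?r X \<bullet> (sum.Assoc A B D \<Otimes> \<iota> X)"
    by (rule sum.iso_cancel_left) simp_all
qed simp

lemma center_mor_prod_Assoc:
  "center_mor (Prod_hb (A \<otimes> B) (Prod_hb A a B b) D d) (Prod_hb A a (B \<otimes> D) (Prod_hb B b D d)) (prod.Assoc A B D)"
proof (rule center_morI)
  fix X assume [simp]: "X \<in> Obj C"
  note push = prod.Assoc_natural prod.Assoc_natural[THEN sum.comp_extend]
    prod.Assoc_natural_right prod.Assoc_natural_right[THEN sum.comp_extend]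
  show "(\<iota> X \<Otimes> prod.Assoc A B D) \<bullet> Prod_hb (A \<otimes> B) (Prod_hb A a B b) D d X
     = Prod_hb A a (B \<otimes> D) (Prod_hb B b D d) X \<bullet> (prod.Assoc A B D \<Otimes> \<iota> X)"
    unfolding Prod_hb_def by (simp add: push prod.Pentagon1[THEN sum.comp_extend] prod.Pentagon2 prod.Pentagon2[THEN sum.comp_extend])
qed simp

lemma center_mor_Ldist:
  "center_mor (Prod_hb A a (B \<oplus> D) (Sum_hb B b D d)) (Sum_hb (A \<otimes> B) (Prod_hb A a B b) (A \<otimes> D) (Prod_hb A a D d)) (Ldist A B D)"
    (is "center_mor ?l ?r _")
proof (rule center_morI)
  fix X assume [simp]: "X \<in> Obj C"
  have [simp]: "src (?l X) = (A \<otimes> (B \<oplus> D)) \<otimes> X" "tgt (?l X) = X \<otimes> A \<otimes> (B \<oplus> D)" "is_iso (?l X)"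
    "src (?r X) = (A \<otimes> B \<oplus> A \<otimes> D) \<otimes> X" "tgt (?r X) = X \<otimes> (A \<otimes> B \<oplus> A \<otimes> D)" "is_iso (?r X)"
    using half_braided_prod[OF A half_braided_sum[OF B D]] half_braided_sum[OF half_braided_prod[OF A B] half_braided_prod[OF A D]]
    by (simp_all add: hb_simps)
  have "Ldist X (A \<otimes> B) (A \<otimes> D) \<bullet> (\<iota> X \<Otimes> Ldist A B D) \<bullet> ?l X
    = (Prod_hb A a B b X \<Oplus> Prod_hb A a D d X) \<bullet> Rdist (A \<otimes> B) (A \<otimes> D) X \<bullet> (Ldist A B D \<Otimes> \<iota> X)"
    unfolding Prod_hb_def Sum_hb_def
    by (simp add: Ldist_prod_assoc[THEN sum.comp_extend3] Ldist_push sum.comp_tens)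
  also have "\<dots> = Ldist X (A \<otimes> B) (A \<otimes> D) \<bullet> ?r X \<bullet> (Ldist A B D \<Otimes> \<iota> X)"
    by (simp add: Sum_hb_cancel[OF half_braided_prod[OF A B] half_braided_prod[OF A D], THEN sum.comp_extend]
      hb_simps[OF half_braided_prod[OF A D]])
  finally show "(\<iota> X \<Otimes> Ldist A B D) \<bullet> ?l X = ?r X \<bullet> (Ldist A B D \<Otimes> \<iota> X)"
    by (rule sum.iso_cancel_left) simp_all
qed simp

lemma center_mor_Rdist:
  "center_mor (Prod_hb (A \<oplus> B) (Sum_hb A a B b) D d) (Sum_hb (A \<otimes> D) (Prod_hb A a D d) (B \<otimes> D) (Prod_hb B b D d)) (Rdist A B D)"
    (is "center_mor ?l ?r _")
proof (rule center_morI)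
  fix X assume [simp]: "X \<in> Obj C"
  have [simp]: "src (?l X) = ((A \<oplus> B) \<otimes> D) \<otimes> X" "tgt (?l X) = X \<otimes> (A \<oplus> B) \<otimes> D" "is_iso (?l X)"
    "src (?r X) = (A \<otimes> D \<oplus> B \<otimes> D) \<otimes> X" "tgt (?r X) = X \<otimes> (A \<otimes> D \<oplus> B \<otimes> D)" "is_iso (?r X)"
    using half_braided_prod[OF half_braided_sum[OF A B] D] half_braided_sum[OF half_braided_prod[OF A D] half_braided_prod[OF B D]]
    by (simp_all add: hb_simps)
  have "Ldist X (A \<otimes> D) (B \<otimes> D) \<bullet> (\<iota> X \<Otimes> Rdist A B D) \<bullet> ?l X
    = (Prod_hb A a D d X \<Oplus> Prod_hb B b D d X) \<bullet> Rdist (A \<otimes> D) (B \<otimes> D) X \<bullet> (Rdist A B D \<Otimes> \<iota> X)"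
    unfolding Prod_hb_def Sum_hb_def
    by (simp add: Ldist_push Rdist_push sum.comp_tens Rdist_prod_assoc[symmetric])
  also have "\<dots> = Ldist X (A \<otimes> D) (B \<otimes> D) \<bullet> ?r X \<bullet> (Rdist A B D \<Otimes> \<iota> X)"
    by (simp add: Sum_hb_cancel[OF half_braided_prod[OF A D] half_braided_prod[OF B D], THEN sum.comp_extend]
      hb_simps[OF half_braided_prod[OF A D]] hb_simps[OF half_braided_prod[OF B D]])
  finally show "(\<iota> X \<Otimes> Rdist A B D) \<bullet> ?l X = ?r X \<bullet> (Rdist A B D \<Otimes> \<iota> X)"
    by (rule sum.iso_cancel_left) simp_all
qed simp

end

end

end

section \<open>The center in terms of arrows with source and target\<close>

context tight_bimonoidal_category
begin

definition hb where
  "hb P X = Arrow (fst P \<otimes> X) (snd P X) (X \<otimes> fst P)"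

lemma hb_sel [simp]: "src (hb P X) = fst P \<otimes> X" "mor (hb P X) = snd P X" "tgt (hb P X) = X \<otimes> fst P"
  by (simp_all add: hb_def)

lemma half_braiding_iff:
  assumes A: "A \<in> Obj C"
  shows "half_braiding C A \<beta> \<longleftrightarrow> \<beta> \<in> extensional (Obj C) \<and> half_braided C A (hb (A, \<beta>))"
proof safe
  assume *: "half_braiding C A \<beta>"
  show "\<beta> \<in> extensional (Obj C)" using * by (simp add: half_braiding_def)
  show "half_braided C A (hb (A, \<beta>))"
  proof
    fix f Y assume "arr f" "tgt f = Y"
    then show "hb (A, \<beta>) Y \<bullet> (\<iota> A \<Otimes> f) = (f \<Otimes> \<iota> A) \<bullet> hb (A, \<beta>) (src f)"
      using * by (auto simp add: half_braiding_def hb_def lift_defs sum.arr_def)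
  qed (use A * in \<open>auto simp add: half_braiding_def hb_def lift_defs sum.is_iso_def sum.inv_of_def\<close>)
next
  assume ext: "\<beta> \<in> extensional (Obj C)" and *: "half_braided C A (hb (A, \<beta>))"
  interpret half_braided C A "hb (A, \<beta>)" by fact
  show "half_braiding C A \<beta>"
    unfolding half_braiding_def
  proof (intro conjI ballI allI)
    fix X assume "X \<in> Obj C"
    then show "iso_arr C (A \<otimes> X) (X \<otimes> A) (\<beta> X)" using hb_iso[of X] by (simp add: sum.is_iso_def hb_def)
  next
    fix X Y f assume "f \<in> Hom C X Y"
    then show "\<beta> Y \<cdot> (\<i>\<d> A \<boxtimes> f) = (f \<boxtimes> \<i>\<d> A) \<cdot> \<beta> X"
      using hb_natural[of "Arrow X f Y" Y] by (simp add: sum.arr_def hb_def lift_defs)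
  next
    fix X Y assume "X \<in> Obj C" "Y \<in> Obj C"
    then show "\<beta> (X \<otimes> Y) = inv_arr C ((X \<otimes> Y) \<otimes> A) (X \<otimes> (Y \<otimes> A)) (\<alpha>\<^sup>\<otimes> X Y A)
        \<cdot> (\<i>\<d> X \<boxtimes> \<beta> Y) \<cdot> \<alpha>\<^sup>\<otimes> X A Y \<cdot> (\<beta> X \<boxtimes> \<i>\<d> Y)
        \<cdot> inv_arr C ((A \<otimes> X) \<otimes> Y) (A \<otimes> (X \<otimes> Y)) (\<alpha>\<^sup>\<otimes> A X Y)"
      using hb_prod[of X Y] by (simp add: hb_def lift_defs sum.inv_of_def)
  next
    fix X Y assume "X \<in> Obj C" "Y \<in> Obj C"
    then show "\<delta>\<^sup>r X Y A \<cdot> \<beta> (X \<oplus> Y) = (\<beta> X \<boxplus> \<beta> Y) \<cdot> \<delta>\<^sup>l A X Y"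
      using hb_sum[of X Y] by (simp add: hb_def lift_defs)
  next
    show "\<lambda>\<^sup>\<bullet> A \<cdot> \<beta> \<zero> = \<rho>\<^sup>\<bullet> A"
      using hb_null by (simp add: hb_def lift_defs)
  qed (fact ext)
qed

lemma center_obj_iff:
  "P \<in> center_obj C \<longleftrightarrow> snd P \<in> extensional (Obj C) \<and> half_braided C (fst P) (hb P)"
  using half_braiding_iff[of "fst P" "snd P"] half_braided.hb_obj[of C "fst P" "hb P"]
  by (cases P) (auto simp add: center_obj_def)

lemma center_objD [simp]:
  assumes "P \<in> center_obj C"
  shows "fst P \<in> Obj C" "half_braided C (fst P) (hb P)" "X \<in> Obj C \<Longrightarrow> is_iso (hb P X)"
  using assms hb_simps[of "fst P" "hb P"] by (auto simp add: center_obj_iff)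

text \<open>
  The half braidings of composite objects are extended by \<open>undefined\<close> off \<open>Obj C\<close>, so they agree
  with \<open>Sum_hb\<close> and the other families on \<open>Obj C\<close> only.
\<close>

lemma half_braided_cong:
  assumes *: "half_braided C A a" and eq: "\<And>X. X \<in> Obj C \<Longrightarrow> b X = a X"
  shows "half_braided C A b"
proof -
  interpret half_braided C A a by fact
  show ?thesis
    by unfold_locales (use hb_natural in \<open>auto simp add: eq hb_prod hb_sum hb_null\<close>)
qed

lemma hb_center_sum: "X \<in> Obj C \<Longrightarrow> hb (center_sum C P Q) X = Sum_hb (fst P) (hb P) (fst Q) (hb Q) X"
  by (simp add: hb_def center_sum_def Sum_hb_def lift_defs sum.inv_of_def case_prod_beta)

lemma hb_center_prod: "X \<in> Obj C \<Longrightarrow> hb (center_prod C P Q) X = Prod_hb (fst P) (hb P) (fst Q) (hb Q) X"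
  by (simp add: hb_def center_prod_def Prod_hb_def lift_defs sum.inv_of_def case_prod_beta)

lemma hb_center_zero: "X \<in> Obj C \<Longrightarrow> hb (center_zero C) X = Zero_hb X"
  by (simp add: hb_def center_zero_def Zero_hb_def lift_defs sum.inv_of_def)

lemma hb_center_one: "X \<in> Obj C \<Longrightarrow> hb (center_one C) X = One_hb X"
  by (simp add: hb_def center_one_def One_hb_def lift_defs sum.inv_of_def)

lemma fst_center [simp]:
  "fst (center_sum C P Q) = fst P \<oplus> fst Q" "fst (center_prod C P Q) = fst P \<otimes> fst Q"
  "fst (center_zero C) = \<zero>" "fst (center_one C) = \<one>"
  by (simp_all add: center_sum_def center_prod_def center_zero_def center_one_def case_prod_beta)

lemma center_obj_ops [simp]:
  "\<lbrakk>P \<in> center_obj C; Q \<in> center_obj C\<rbrakk> \<Longrightarrow> center_sum C P Q \<in> center_obj C"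
  "\<lbrakk>P \<in> center_obj C; Q \<in> center_obj C\<rbrakk> \<Longrightarrow> center_prod C P Q \<in> center_obj C"
  "center_zero C \<in> center_obj C" "center_one C \<in> center_obj C"
  unfolding center_obj_iff
  by (auto intro!: half_braided_sum half_braided_prod half_braided_zero half_braided_one
        intro: half_braided_cong simp add: hb_center_sum hb_center_prod hb_center_zero hb_center_one)
     (simp_all add: center_sum_def center_prod_def center_zero_def center_one_def case_prod_beta)

end

section \<open>The center is a tight braided bimonoidal category\<close>

context tight_bimonoidal_category
begin

lemma center_hom_iff:
  "f \<in> center_hom C P Q \<longleftrightarrow> P \<in> center_obj C \<and> Q \<in> center_obj C
     \<and> center_mor (hb P) (hb Q) (Arrow (fst P) f (fst Q))"
  by (cases P; cases Q) (auto simp add: center_hom_def center_mor_def sum.arr_def hb_def lift_defs)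

lemma center_homI:
  assumes "center_mor a b F" "P \<in> center_obj C" "Q \<in> center_obj C"
    and "\<And>X. X \<in> Obj C \<Longrightarrow> hb P X = a X" "\<And>X. X \<in> Obj C \<Longrightarrow> hb Q X = b X"
    and "F = Arrow (fst P) f (fst Q)"
  shows "f \<in> center_hom C P Q"
  using assms by (simp add: center_hom_iff center_mor_def)

lemma center_homD:
  assumes "f \<in> center_hom C P Q"
  shows "P \<in> center_obj C" "Q \<in> center_obj C" "f \<in> Hom C (fst P) (fst Q)"
  using assms by (auto simp add: center_hom_iff center_mor_def sum.arr_def)

lemma center_hom_id: "P \<in> center_obj C \<Longrightarrow> \<i>\<d> (fst P) \<in> center_hom C P P"
  by (rule center_homI[OF center_mor_id]) (auto simp add: lift_defs)

lemma center_hom_comp: "\<lbrakk>f \<in> center_hom C P Q; g \<in> center_hom C Q R\<rbrakk> \<Longrightarrow> g \<cdot> f \<in> center_hom C P R"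
  unfolding center_hom_iff
  using center_mor_comp[of "fst P" "hb P" "fst Q" "hb Q" "fst R" "hb R" "Arrow (fst P) f (fst Q)" "Arrow (fst Q) g (fst R)"]
  by (simp add: lift_defs)

lemma center_hom_inv:
  "\<lbrakk>f \<in> center_hom C P Q; iso_arr C (fst P) (fst Q) f\<rbrakk> \<Longrightarrow> inv_arr C (fst P) (fst Q) f \<in> center_hom C Q P"
  unfolding center_hom_iff
  using center_mor_inv[of "fst P" "hb P" "fst Q" "hb Q" "Arrow (fst P) f (fst Q)"]
  by (simp add: sum.is_iso_def sum.inv_of_def)

lemma center_hom_sum:
  "\<lbrakk>f \<in> center_hom C P P'; g \<in> center_hom C Q Q'\<rbrakk> \<Longrightarrow> f \<boxplus> g \<in> center_hom C (center_sum C P Q) (center_sum C P' Q')"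
  by (rule center_homI[OF center_mor_sum[of "fst P" "hb P" "fst Q" "hb Q" "fst P'" "hb P'" "fst Q'" "hb Q'"
        "Arrow (fst P) f (fst P')" "Arrow (fst Q) g (fst Q')"]])
     (auto simp add: center_hom_iff hb_center_sum lift_defs)

lemma center_hom_prod:
  "\<lbrakk>f \<in> center_hom C P P'; g \<in> center_hom C Q Q'\<rbrakk> \<Longrightarrow> f \<boxtimes> g \<in> center_hom C (center_prod C P Q) (center_prod C P' Q')"
  by (rule center_homI[OF center_mor_prod[of "fst P" "hb P" "fst Q" "hb Q" "fst P'" "hb P'" "fst Q'" "hb Q'"
        "Arrow (fst P) f (fst P')" "Arrow (fst Q) g (fst Q')"]])
     (auto simp add: center_hom_iff hb_center_prod lift_defs)

lemma center_hom_sum_assoc: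
  "\<lbrakk>P \<in> center_obj C; Q \<in> center_obj C; R \<in> center_obj C\<rbrakk> \<Longrightarrow>
    \<alpha>\<^sup>\<oplus> (fst P) (fst Q) (fst R) \<in> center_hom C (center_sum C (center_sum C P Q) R) (center_sum C P (center_sum C Q R))"
  by (rule center_homI[OF center_mor_sum_Assoc[of "fst P" "hb P" "fst Q" "hb Q" "fst R" "hb R"]])
    (simp_all add: hb_center_sum Sum_hb_def sum.Assoc_def)

lemma center_hom_prod_assoc:
  "\<lbrakk>P \<in> center_obj C; Q \<in> center_obj C; R \<in> center_obj C\<rbrakk> \<Longrightarrow>
    \<alpha>\<^sup>\<otimes> (fst P) (fst Q) (fst R) \<in> center_hom C (center_prod C (center_prod C P Q) R) (center_prod C P (center_prod C Q R))"
  by (rule center_homI[OF center_mor_prod_Assoc[of "fst P" "hb P" "fst Q" "hb Q" "fst R" "hb R"]])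
    (simp_all add: hb_center_prod Prod_hb_def prod.Assoc_def)

lemma center_hom_ldist:
  "\<lbrakk>P \<in> center_obj C; Q \<in> center_obj C; R \<in> center_obj C\<rbrakk> \<Longrightarrow>
    \<delta>\<^sup>l (fst P) (fst Q) (fst R) \<in> center_hom C (center_prod C P (center_sum C Q R)) (center_sum C (center_prod C P Q) (center_prod C P R))"
  by (rule center_homI[OF center_mor_Ldist[of "fst P" "hb P" "fst Q" "hb Q" "fst R" "hb R"]])
    (simp_all add: hb_center_sum hb_center_prod Sum_hb_def Prod_hb_def Ldist_def)

lemma center_hom_rdist:
  "\<lbrakk>P \<in> center_obj C; Q \<in> center_obj C; R \<in> center_obj C\<rbrakk> \<Longrightarrow>
    \<delta>\<^sup>r (fst P) (fst Q) (fst R) \<in> center_hom C (center_prod C (center_sum C P Q) R) (center_sum C (center_prod C P R) (center_prod C Q R))"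
  by (rule center_homI[OF center_mor_Rdist[of "fst P" "hb P" "fst Q" "hb Q" "fst R" "hb R"]])
    (simp_all add: hb_center_sum hb_center_prod Sum_hb_def Prod_hb_def Rdist_def)

lemma center_hom_sum_sym:
  "\<lbrakk>P \<in> center_obj C; Q \<in> center_obj C\<rbrakk> \<Longrightarrow> \<zeta>\<^sup>\<oplus> (fst P) (fst Q) \<in> center_hom C (center_sum C P Q) (center_sum C Q P)"
  by (rule center_homI[OF center_mor_sum_braid[of "fst P" "hb P" "fst Q" "hb Q"]])
    (simp_all add: hb_center_sum sum.Braid_def)

lemma center_hom_half_braiding:
  "\<lbrakk>P \<in> center_obj C; Q \<in> center_obj C\<rbrakk> \<Longrightarrow> snd P (fst Q) \<in> center_hom C (center_prod C P Q) (center_prod C Q P)"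
  by (rule center_homI[OF center_mor_braiding[of "fst P" "hb P" "fst Q" "hb Q"]])
    (simp_all add: hb_center_prod arrow.expand)

lemma center_hom_sum_lunit:
  "P \<in> center_obj C \<Longrightarrow>
    \<lambda>\<^sup>\<oplus> (fst P) \<in> center_hom C (center_sum C (center_zero C) P) P"
  by (rule center_homI[OF center_mor_sum_Lunit[of "fst P" "hb P"]])
    (simp_all add: hb_center_sum hb_center_zero Sum_hb_def sum.Lunit_def)

lemma center_hom_sum_runit:
  "P \<in> center_obj C \<Longrightarrow>
    \<rho>\<^sup>\<oplus> (fst P) \<in> center_hom C (center_sum C P (center_zero C)) P"
  by (rule center_homI[OF center_mor_sum_Runit[of "fst P" "hb P"]])
    (simp_all add: hb_center_sum hb_center_zero Sum_hb_def sum.Runit_def)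

lemma center_hom_prod_lunit:
  "P \<in> center_obj C \<Longrightarrow>
    \<lambda>\<^sup>\<otimes> (fst P) \<in> center_hom C (center_prod C (center_one C) P) P"
  by (rule center_homI[OF center_mor_prod_Lunit[of "fst P" "hb P"]])
    (simp_all add: hb_center_prod hb_center_one Prod_hb_def prod.Lunit_def)

lemma center_hom_prod_runit:
  "P \<in> center_obj C \<Longrightarrow>
    \<rho>\<^sup>\<otimes> (fst P) \<in> center_hom C (center_prod C P (center_one C)) P"
  by (rule center_homI[OF center_mor_prod_Runit[of "fst P" "hb P"]])
    (simp_all add: hb_center_prod hb_center_one Prod_hb_def prod.Runit_def)

lemma center_hom_lnull:
  "P \<in> center_obj C \<Longrightarrow>
    \<lambda>\<^sup>\<bullet> (fst P) \<in> center_hom C (center_prod C (center_zero C) P) (center_zero C)"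
  by (rule center_homI[OF center_mor_Lnull[of "fst P" "hb P"]])
    (simp_all add: hb_center_prod hb_center_zero Prod_hb_def Lnull_def)

lemma center_hom_rnull:
  "P \<in> center_obj C \<Longrightarrow>
    \<rho>\<^sup>\<bullet> (fst P) \<in> center_hom C (center_prod C P (center_zero C)) (center_zero C)"
  by (rule center_homI[OF center_mor_Rnull[of "fst P" "hb P"]])
    (simp_all add: hb_center_prod hb_center_zero Prod_hb_def Rnull_def)

lemmas center_hom_structure = center_hom_sum_assoc center_hom_prod_assoc center_hom_ldist center_hom_rdist
  center_hom_sum_sym center_hom_half_braiding center_hom_sum_lunit center_hom_sum_runit center_hom_prod_lunit
  center_hom_prod_runit center_hom_lnull center_hom_rnull

abbreviation "Z \<equiv> bimonoidal_Drinfeld_center C"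

lemma Z_simps [simp]:
  "Obj Z = center_obj C" "Hom Z = center_hom C" "Ident Z P = \<i>\<d> (fst P)" "Comp Z = (\<cdot>)"
  "sum_obj Z = center_sum C" "sum_arr Z = (\<boxplus>)" "zero_obj Z = center_zero C"
  "sum_assoc Z P Q R = \<alpha>\<^sup>\<oplus> (fst P) (fst Q) (fst R)"
  "sum_lunit Z P = \<lambda>\<^sup>\<oplus> (fst P)" "sum_runit Z P = \<rho>\<^sup>\<oplus> (fst P)" "sum_sym Z P Q = \<zeta>\<^sup>\<oplus> (fst P) (fst Q)"
  "prod_obj Z = center_prod C" "prod_arr Z = (\<boxtimes>)" "one_obj Z = center_one C"
  "prod_assoc Z P Q R = \<alpha>\<^sup>\<otimes> (fst P) (fst Q) (fst R)"
  "prod_lunit Z P = \<lambda>\<^sup>\<otimes> (fst P)" "prod_runit Z P = \<rho>\<^sup>\<otimes> (fst P)"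
  "lnull Z P = \<lambda>\<^sup>\<bullet> (fst P)" "rnull Z P = \<rho>\<^sup>\<bullet> (fst P)"
  "ldist Z P Q R = \<delta>\<^sup>l (fst P) (fst Q) (fst R)" "rdist Z P Q R = \<delta>\<^sup>r (fst P) (fst Q) (fst R)"
  "prod_braid Z P Q = snd P (fst Q)"
  by (simp_all add: bimonoidal_Drinfeld_center_def case_prod_beta)

lemma center_category: "category Z"
  by unfold_locales
    (auto simp add: center_hom_id center_hom_comp dest: center_homD intro: sum.comp_id_left sum.comp_id_right sum.comp_assoc)

interpretation Z: category Z by (rule center_category)

text \<open>
  Isomorphisms, and hence the inverses that occur in the axioms, are the same in the center as in \<open>C\<close>.
\<close>

lemma center_inverse:
  assumes "f \<in> center_hom C P Q" "iso_arr C (fst P) (fst Q) f"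
  shows "inverse_arrows Z P Q f (inv_arr C (fst P) (fst Q) f)"
  using assms center_hom_inv[OF assms] sum.inverse_arrows_inv_arr[OF assms(2)]
  by (simp add: inverse_arrows_def)

lemma center_iso: "\<lbrakk>f \<in> center_hom C P Q; iso_arr C (fst P) (fst Q) f\<rbrakk> \<Longrightarrow> iso_arr Z P Q f"
  unfolding iso_arr_def[of Z] using center_inverse by blast

lemma center_inv: "\<lbrakk>f \<in> center_hom C P Q; iso_arr C (fst P) (fst Q) f\<rbrakk> \<Longrightarrow> inv_arr Z P Q f = inv_arr C (fst P) (fst Q) f"
  using center_inverse Z.inv_arr_eq by blast

lemma iso_arr_half_braiding:
  "\<lbrakk>P \<in> center_obj C; Q \<in> center_obj C\<rbrakk> \<Longrightarrow> iso_arr C (fst P \<otimes> fst Q) (fst Q \<otimes> fst P) (snd P (fst Q))"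
  using center_objD(3)[of P "fst Q"] by (simp add: sum.is_iso_def)

lemma center_structure_iso:
  "\<lbrakk>P \<in> center_obj C; Q \<in> center_obj C; R \<in> center_obj C\<rbrakk> \<Longrightarrow>
    iso_arr Z (center_sum C (center_sum C P Q) R) (center_sum C P (center_sum C Q R)) (\<alpha>\<^sup>\<oplus> (fst P) (fst Q) (fst R))"
  "\<lbrakk>P \<in> center_obj C; Q \<in> center_obj C; R \<in> center_obj C\<rbrakk> \<Longrightarrow>
    iso_arr Z (center_prod C (center_prod C P Q) R) (center_prod C P (center_prod C Q R)) (\<alpha>\<^sup>\<otimes> (fst P) (fst Q) (fst R))"
  "\<lbrakk>P \<in> center_obj C; Q \<in> center_obj C; R \<in> center_obj C\<rbrakk> \<Longrightarrow>
    iso_arr Z (center_prod C P (center_sum C Q R)) (center_sum C (center_prod C P Q) (center_prod C P R)) (\<delta>\<^sup>l (fst P) (fst Q) (fst R))"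
  "\<lbrakk>P \<in> center_obj C; Q \<in> center_obj C; R \<in> center_obj C\<rbrakk> \<Longrightarrow>
    iso_arr Z (center_prod C (center_sum C P Q) R) (center_sum C (center_prod C P R) (center_prod C Q R)) (\<delta>\<^sup>r (fst P) (fst Q) (fst R))"
  "\<lbrakk>P \<in> center_obj C; Q \<in> center_obj C\<rbrakk> \<Longrightarrow> iso_arr Z (center_sum C P Q) (center_sum C Q P) (\<zeta>\<^sup>\<oplus> (fst P) (fst Q))"
  "\<lbrakk>P \<in> center_obj C; Q \<in> center_obj C\<rbrakk> \<Longrightarrow> iso_arr Z (center_prod C P Q) (center_prod C Q P) (snd P (fst Q))"
  "P \<in> center_obj C \<Longrightarrow> iso_arr Z (center_sum C (center_zero C) P) P (\<lambda>\<^sup>\<oplus> (fst P))"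
  "P \<in> center_obj C \<Longrightarrow> iso_arr Z (center_sum C P (center_zero C)) P (\<rho>\<^sup>\<oplus> (fst P))"
  "P \<in> center_obj C \<Longrightarrow> iso_arr Z (center_prod C (center_one C) P) P (\<lambda>\<^sup>\<otimes> (fst P))"
  "P \<in> center_obj C \<Longrightarrow> iso_arr Z (center_prod C P (center_one C)) P (\<rho>\<^sup>\<otimes> (fst P))"
  "P \<in> center_obj C \<Longrightarrow> iso_arr Z (center_prod C (center_zero C) P) (center_zero C) (\<lambda>\<^sup>\<bullet> (fst P))"
  "P \<in> center_obj C \<Longrightarrow> iso_arr Z (center_prod C P (center_zero C)) (center_zero C) (\<rho>\<^sup>\<bullet> (fst P))"
  by (rule center_iso; simp add: center_hom_structure sum.assoc_iso prod.assoc_iso ldist_iso rdist_iso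
    sum.braiding_iso iso_arr_half_braiding sum.lunit_iso sum.runit_iso prod.lunit_iso prod.runit_iso lnull_iso rnull_iso)+

lemma center_inv_assoc:
  "\<lbrakk>P \<in> center_obj C; Q \<in> center_obj C; R \<in> center_obj C\<rbrakk> \<Longrightarrow>
    inv_arr Z (center_sum C (center_sum C P Q) R) (center_sum C P (center_sum C Q R)) (\<alpha>\<^sup>\<oplus> (fst P) (fst Q) (fst R))
      = inv_arr C ((fst P \<oplus> fst Q) \<oplus> fst R) (fst P \<oplus> fst Q \<oplus> fst R) (\<alpha>\<^sup>\<oplus> (fst P) (fst Q) (fst R))"
  "\<lbrakk>P \<in> center_obj C; Q \<in> center_obj C; R \<in> center_obj C\<rbrakk> \<Longrightarrow>
    inv_arr Z (center_prod C (center_prod C P Q) R) (center_prod C P (center_prod C Q R)) (\<alpha>\<^sup>\<otimes> (fst P) (fst Q) (fst R))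
      = inv_arr C ((fst P \<otimes> fst Q) \<otimes> fst R) (fst P \<otimes> fst Q \<otimes> fst R) (\<alpha>\<^sup>\<otimes> (fst P) (fst Q) (fst R))"
  using center_inv[OF center_hom_sum_assoc, of P Q R] center_inv[OF center_hom_prod_assoc, of P Q R]
  by (simp_all add: sum.assoc_iso prod.assoc_iso)

lemmas center_intros = center_hom_id center_hom_comp center_hom_sum center_hom_prod center_hom_structure center_obj_ops
  center_structure_iso center_objD(1)

text \<open>
  A half braiding is natural in \<open>X\<close> by definition. Naturality in the other variable is the condition on arrows
  of the center.
\<close>

lemma half_braiding_natural:
  assumes "half_braided C A a" "half_braided C A' a'" "center_mor a a' f" "src f = A" "tgt f = A'" "arr g"
  shows "a' (tgt g) \<bullet> (f \<Otimes> g) = (g \<Otimes> f) \<bullet> a (src g)"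
proof -
  interpret a: half_braided C A a by fact
  interpret a': half_braided C A' a' by fact
  note [simp] = assms(4-6) center_mor_arr[OF assms(3)]
  have "a' (tgt g) \<bullet> (f \<Otimes> g) = (a' (tgt g) \<bullet> (\<iota> A' \<Otimes> g)) \<bullet> (f \<Otimes> \<iota> (src g))"
    by (simp add: prod.tens_tens)
  also have "\<dots> = (g \<Otimes> \<iota> A') \<bullet> (a' (src g) \<bullet> (f \<Otimes> \<iota> (src g)))"
    by (simp add: a'.hb_natural)
  also have "\<dots> = (g \<Otimes> f) \<bullet> a (src g)"
    by (simp add: prod.tens_tens flip: center_mor_eq[OF assms(3)])
  finally show ?thesis .
qed

lemma center_braiding_natural:
  assumes f: "f \<in> center_hom C P P'" and g: "g \<in> center_hom C Q Q'"
  shows "snd P' (fst Q') \<cdot> (f \<boxtimes> g) = (g \<boxtimes> f) \<cdot> snd P (fst Q)"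
  using half_braiding_natural[of "fst P" "hb P" "fst P'" "hb P'" "Arrow (fst P) f (fst P')" "Arrow (fst Q) g (fst Q')"]
    f center_homD(3)[OF g]
  by (auto simp add: center_hom_iff hb_def lift_defs sum.arr_def)

lemma center_hexagon_right:
  assumes "P \<in> center_obj C" "Q \<in> center_obj C" "R \<in> center_obj C"
  shows "\<alpha>\<^sup>\<otimes> (fst Q) (fst R) (fst P) \<cdot> snd P (fst Q \<otimes> fst R) \<cdot> \<alpha>\<^sup>\<otimes> (fst P) (fst Q) (fst R)
    = (\<i>\<d> (fst Q) \<boxtimes> snd P (fst R)) \<cdot> \<alpha>\<^sup>\<otimes> (fst Q) (fst P) (fst R) \<cdot> (snd P (fst Q) \<boxtimes> \<i>\<d> (fst R))"
proof -
  interpret P: half_braided C "fst P" "hb P" using assms by simp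
  have [simp]: "fst Q \<in> Obj C" "fst R \<in> Obj C" using assms by simp_all
  have "prod.Assoc (fst Q) (fst R) (fst P) \<bullet> hb P (fst Q \<otimes> fst R) \<bullet> prod.Assoc (fst P) (fst Q) (fst R)
    = (\<iota> (fst Q) \<Otimes> hb P (fst R)) \<bullet> prod.Assoc (fst Q) (fst P) (fst R) \<bullet> (hb P (fst Q) \<Otimes> \<iota> (fst R))"
    by (simp add: P.hb_prod)
  then show ?thesis by (simp add: hb_def lift_defs)
qed

text \<open>
  The associators at the two ends cancel those in the definition of the product of half braidings.
\<close>

lemma center_hexagon_left:
  assumes "P \<in> center_obj C" "Q \<in> center_obj C" "R \<in> center_obj C"
  shows "inv_arr C ((fst R \<otimes> fst P) \<otimes> fst Q) (fst R \<otimes> fst P \<otimes> fst Q) (\<alpha>\<^sup>\<otimes> (fst R) (fst P) (fst Q))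
      \<cdot> snd (center_prod C P Q) (fst R)
      \<cdot> inv_arr C ((fst P \<otimes> fst Q) \<otimes> fst R) (fst P \<otimes> fst Q \<otimes> fst R) (\<alpha>\<^sup>\<otimes> (fst P) (fst Q) (fst R))
    = (snd P (fst R) \<boxtimes> \<i>\<d> (fst Q))
      \<cdot> inv_arr C ((fst P \<otimes> fst R) \<otimes> fst Q) (fst P \<otimes> fst R \<otimes> fst Q) (\<alpha>\<^sup>\<otimes> (fst P) (fst R) (fst Q))
      \<cdot> (\<i>\<d> (fst P) \<boxtimes> snd Q (fst R))"
proof -
  have [simp]: "fst P \<in> Obj C" "fst Q \<in> Obj C" "fst R \<in> Obj C" "is_iso (hb P (fst R))" "is_iso (hb Q (fst R))"
    using assms by simp_all
  have "inv_of (prod.Assoc (fst R) (fst P) (fst Q)) \<bullet> hb (center_prod C P Q) (fst R)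
      \<bullet> inv_of (prod.Assoc (fst P) (fst Q) (fst R))
    = (hb P (fst R) \<Otimes> \<iota> (fst Q)) \<bullet> inv_of (prod.Assoc (fst P) (fst R) (fst Q)) \<bullet> (\<iota> (fst P) \<Otimes> hb Q (fst R))"
    by (simp add: hb_center_prod Prod_hb_def)
  then show ?thesis by (simp add: hb_def lift_defs sum.inv_of_def)
qed

lemma center_sum_monoidal:
  "symmetric_monoidal_category Z (sum_obj Z) (sum_arr Z) (zero_obj Z) (sum_assoc Z) (sum_lunit Z) (sum_runit Z) (sum_sym Z)"
  by ((unfold_locales; simp only: Z_simps fst_center center_inv_assoc), simp_all only: center_intros sum.pentagon sum.triangle sum.symmetry sum.tens_id,
    (rule sum.tens_comp sum.assoc_nat sum.lunit_nat sum.runit_nat sum.braiding_nat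
   sum.hexagon_left sum.hexagon_right; blast intro: center_objD(1) dest: center_homD)+)

lemma center_prod_monoidal:
  "braided_monoidal_category Z (prod_obj Z) (prod_arr Z) (one_obj Z) (prod_assoc Z) (prod_lunit Z) (prod_runit Z) (prod_braid Z)"
  by ((unfold_locales; simp only: Z_simps fst_center center_inv_assoc), simp_all only: center_intros prod.pentagon prod.triangle prod.tens_id
     center_hexagon_left center_hexagon_right center_braiding_natural,
    (rule prod.tens_comp prod.assoc_nat prod.lunit_nat prod.runit_nat; blast intro: center_objD(1) dest: center_homD)+)

lemma center_middle:
  "\<lbrakk>P \<in> center_obj C; Q \<in> center_obj C; R \<in> center_obj C; S \<in> center_obj C\<rbrakk> \<Longrightarrow>
    sum_middle Z P Q R S = \<mu> (fst P) (fst Q) (fst R) (fst S)"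
  using center_inv_assoc(1)[of P R "center_sum C Q S"] by (simp add: sum_middle_def center_inv_assoc)

lemma center_mono:
  "\<lbrakk>f \<in> center_hom C P Q; mono_arr C (fst P) (fst Q) f\<rbrakk> \<Longrightarrow> mono_arr Z P Q f"
  unfolding mono_arr_def by (auto dest!: center_homD(3))

lemma center_bimonoidal: "bimonoidal_category Z"
proof (intro bimonoidal_category.intro bimonoidal_category_axioms.intro)
  show "symmetric_monoidal_category Z (sum_obj Z) (sum_arr Z) (zero_obj Z) (sum_assoc Z) (sum_lunit Z) (sum_runit Z) (sum_sym Z)"
    by (rule center_sum_monoidal)
  show "monoidal_category Z (prod_obj Z) (prod_arr Z) (one_obj Z) (prod_assoc Z) (prod_lunit Z) (prod_runit Z)"
    using center_prod_monoidal by (simp add: braided_monoidal_category_def)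
qed (simp_all only: Z_simps fst_center center_middle center_intros,
   simp_all add: ldist_sym rdist_sym rdist_sum_assoc ldist_sum_assoc ldist_prod_assoc rdist_prod_assoc
     ldist_rdist_prod_assoc ldist_rdist_middle lnull_rnull_zero lnull_sum rnull_sum prod_runit_zero prod_lunit_zero
     lnull_prod null_middle_prod rnull_prod ldist_zero_left rdist_zero_left ldist_zero_right rdist_zero_right
     prod_lunit_sum prod_runit_sum center_mono ldist_mono rdist_mono center_hom_structure,
   (rule lnull_nat rnull_nat ldist_nat rdist_nat; blast dest: center_homD)+)

lemma center_tight_braided: "tight_braided_bimonoidal_category Z"
proof -
  have rdist_braid: "\<delta>\<^sup>r (fst Q) (fst R) (fst P) \<cdot> snd P (fst Q \<oplus> fst R)
      = (snd P (fst Q) \<boxplus> snd P (fst R)) \<cdot> \<delta>\<^sup>l (fst P) (fst Q) (fst R)"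
    if "P \<in> center_obj C" "Q \<in> center_obj C" "R \<in> center_obj C" for P Q R
    using half_braided.hb_sum[of C "fst P" "hb P" "fst Q" "fst R"] that by (simp add: hb_def lift_defs)
  have ldist_braid: "\<delta>\<^sup>l (fst R) (fst P) (fst Q) \<cdot> snd (center_sum C P Q) (fst R)
      = (snd P (fst R) \<boxplus> snd Q (fst R)) \<cdot> \<delta>\<^sup>r (fst P) (fst Q) (fst R)"
    if "P \<in> center_obj C" "Q \<in> center_obj C" "R \<in> center_obj C" for P Q R
  proof -
    have "Ldist (fst R) (fst P) (fst Q) \<bullet> hb (center_sum C P Q) (fst R)
        = (hb P (fst R) \<Oplus> hb Q (fst R)) \<bullet> Rdist (fst P) (fst Q) (fst R)"
      using that by (simp add: hb_center_sum Sum_hb_cancel)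
    then show ?thesis by (simp add: hb_def lift_defs)
  qed
  have lnull_braid: "\<lambda>\<^sup>\<bullet> (fst P) \<cdot> snd P \<zero> = \<rho>\<^sup>\<bullet> (fst P)" if "P \<in> center_obj C" for P
    using half_braided.hb_null[of C "fst P" "hb P"] that by (simp add: hb_def lift_defs)
  have rnull_braid: "\<rho>\<^sup>\<bullet> (fst P) \<cdot> snd (center_zero C) (fst P) = \<lambda>\<^sup>\<bullet> (fst P)" if "P \<in> center_obj C" for P
  proof -
    have "Rnull (fst P) \<bullet> hb (center_zero C) (fst P) = Lnull (fst P)"
      using that by (simp add: hb_center_zero Zero_hb_def)
    then show ?thesis by (simp add: hb_def lift_defs)
  qed
  have "tight_bimonoidal_category Z"
    by (intro tight_bimonoidal_category.intro tight_bimonoidal_category_axioms.intro center_bimonoidal)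
      (simp_all only: Z_simps center_intros)
  moreover have "braided_bimonoidal_category Z"
    by (intro braided_bimonoidal_category.intro braided_bimonoidal_category_axioms.intro center_bimonoidal
        center_prod_monoidal)
      (simp_all only: Z_simps fst_center rdist_braid ldist_braid lnull_braid rnull_braid)
  ultimately show ?thesis
    by (rule tight_braided_bimonoidal_category.intro)
qed

end

theorem mainTheorem7:
  fixes C :: "('o, 'm, 'z) bimonoidal_scheme"
  assumes "tight_bimonoidal_category C"
  shows "tight_braided_bimonoidal_category (bimonoidal_Drinfeld_center C)"
  using assms by (rule tight_bimonoidal_category.center_tight_braided)

end
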